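(* Let $(P_1,P_2,P_3,P_4)$ be a quadruplet of points in $S^3$ which are not cocircular, let $(P_1',P_2',P_3',P_4')$ be its dual quadruplet, and let $\varSigma$ be the $2$-sphere through all the points $P_i$ and $P_j'$. Let $p:\varSigma\to\mathbb{C}\cup\{\infty\}$ be a stereographic projection, and identify $P_i$ and $P_j'$ with $p(P_i)$ and $p(P_j')$, respectively. Then the cross ratio of the dual quadruplet $$\mathrm{cr}'=\frac{P_2'-P_1'}{P_2'-P_4'}\cdot\frac{P_3'-P_4'}{P_3'-P_1'}$$ is equal to the complex conjugate of the cross ratio of the original quadruplet $$\mathrm{cr}=\frac{P_2-P_1}{P_2-P_4}\cdot\frac{P_3-P_4}{P_3-P_1},$$ that is, $\mathrm{cr}'=\overline{\mathrm{cr}}$.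
   Context: Let $P_1,P_2,P_3,P_4$ be four points of the round sphere $S^3$ which are not cocircular, i.e. do not lie on a common round circle (in particular they are distinct); they lie on a (unique) round $2$-sphere $\varSigma\subset S^3$. For pairwise distinct $i,j,k\in\{1,2,3,4\}$ let $\varGamma_{ijk}$ be the circle through $P_i,P_j,P_k$, oriented by the cyclic order $P_i\to P_j\to P_k\to P_i$. The angle between two oriented circles through $P_i$ and $P_j$ is the angle in $[0,\pi]$ between their positive unit tangent vectors at $P_i$ (equivalently at $P_j$). For $\{i,j,k,l\}=\{1,2,3,4\}$ let $\mathcal{S}_{ij}$ be the set of oriented circles in $S^3$ through $P_i$ and $P_j$ which intersect $\varGamma_{ijk}$ and $\varGamma_{ijl}$ in the same angle. The circular angle bisector $\varGamma_{ij}$ of $\varGamma_{ijk}$ and $\varGamma_{ijl}$ is the (unique) circle in $\mathcal{S}_{ij}$ which minimizes the intersection angles with $\varGamma_{ijk}$ and $\varGamma_{ijl}$; it lies on $\varSigma$. The dual quadruplet $(P_1',P_2',P_3',P_4')$ of $(P_1,P_2,P_3,P_4)$ is defined by $\varGamma_{ij}\cap\varGamma_{ik}\cap\varGamma_{il}=\{P_i,P_i'\}$ for $\{i,j,k,l\}=\{1,2,3,4\}$. Equivalently: if $\pi_i:\varSigma\to\varPi_i\cup\{\infty\}$ is a stereographic projection from $P_i$ onto a Euclidean plane $\varPi_i$, then $P_i'=\pi_i^{-1}(\text{incenter of the triangle with vertices }\pi_i(P_j),\pi_i(P_k),\pi_i(P_l))$. In particular all $P_i'$ lie on $\varSigma$.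 Cross ratios in which one of the points is $\infty$ are interpreted by the usual convention (as limits). *)

theory Defs
  imports "HOL-Analysis.Analysis"
begin

abbreviation S3 :: "(real ^ 4) set" where
  "S3 \<equiv> sphere 0 1"

definition circle_point :: "real ^ 4 \<Rightarrow> real \<Rightarrow> real ^ 4 \<Rightarrow> real ^ 4 \<Rightarrow> real \<Rightarrow> real ^ 4" where
  "circle_point c r u v t = c + (r * cos t) *\<^sub>R u + (r * sin t) *\<^sub>R v"

definition circle_tangent :: "real ^ 4 \<Rightarrow> real ^ 4 \<Rightarrow> real \<Rightarrow> real ^ 4" where
  "circle_tangent u v t = cos t *\<^sub>R v - sin t *\<^sub>R u"

definition circle_frame :: "real ^ 4 \<Rightarrow> real \<Rightarrow> real ^ 4 \<Rightarrow> real ^ 4 \<Rightarrow> bool" where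
  "circle_frame c r u v \<longleftrightarrow>
     r > 0 \<and> norm u = 1 \<and> norm v = 1 \<and> u \<bullet> v = 0 \<and> (\<forall>t. circle_point c r u v t \<in> S3)"

text \<open>An oriented circle is encoded as the set of all pairs (point, positive unit tangent vector
  at that point). Two parametrisations thus give the same oriented circle iff they have the same
  trace and the same orientation; a circle and its reverse are different.\<close>

definition oriented_circle ::
    "real ^ 4 \<Rightarrow> real \<Rightarrow> real ^ 4 \<Rightarrow> real ^ 4 \<Rightarrow> ((real ^ 4) \<times> (real ^ 4)) set" where
  "oriented_circle c r u v = range (\<lambda>t. (circle_point c r u v t, circle_tangent u v t))"

definition oriented_circles :: "((real ^ 4) \<times> (real ^ 4)) set set" where
  "oriented_circles = {oriented_circle c r u v | c r u v. circle_frame c r u v}"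

definition points :: "((real ^ 4) \<times> (real ^ 4)) set \<Rightarrow> (real ^ 4) set" where
  "points C = fst ` C"

definition pos_tangent :: "((real ^ 4) \<times> (real ^ 4)) set \<Rightarrow> real ^ 4 \<Rightarrow> real ^ 4" where
  "pos_tangent C x = (THE w. (x, w) \<in> C)"

definition cocircular :: "(real ^ 4) set \<Rightarrow> bool" where
  "cocircular A \<longleftrightarrow> (\<exists>C \<in> oriented_circles. A \<subseteq> points C)"

text \<open>The circle through three points, oriented such that they are passed in the cyclic order
  \<open>P \<rightarrow> Q \<rightarrow> R \<rightarrow> P\<close>.\<close>

definition circle_through ::
    "real ^ 4 \<Rightarrow> real ^ 4 \<Rightarrow> real ^ 4 \<Rightarrow> ((real ^ 4) \<times> (real ^ 4)) set" where
  "circle_through P Q R = (THE C. \<exists>c r u v t1 t2 t3.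
     circle_frame c r u v \<and> C = oriented_circle c r u v \<and>
     t1 < t2 \<and> t2 < t3 \<and> t3 < t1 + 2 * pi \<and>
     P = circle_point c r u v t1 \<and> Q = circle_point c r u v t2 \<and> R = circle_point c r u v t3)"

text \<open>Angle at the common point \<open>P\<close>, a value in \<open>[0, pi]\<close>.\<close>

definition circle_angle ::
    "real ^ 4 \<Rightarrow> ((real ^ 4) \<times> (real ^ 4)) set \<Rightarrow> ((real ^ 4) \<times> (real ^ 4)) set \<Rightarrow> real" where
  "circle_angle P C D = arccos (pos_tangent C P \<bullet> pos_tangent D P)"

definition equal_angle_circles ::
    "real ^ 4 \<Rightarrow> real ^ 4 \<Rightarrow> real ^ 4 \<Rightarrow> real ^ 4 \<Rightarrow> ((real ^ 4) \<times> (real ^ 4)) set set" where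
  "equal_angle_circles P Q R T =
     {C \<in> oriented_circles. P \<in> points C \<and> Q \<in> points C \<and>
        circle_angle P C (circle_through P Q R) = circle_angle P C (circle_through P Q T)}"

text \<open>On \<^const>\<open>equal_angle_circles\<close> the two intersection angles agree, so that minimising
  one of them is minimising both.\<close>

definition angle_bisector ::
    "real ^ 4 \<Rightarrow> real ^ 4 \<Rightarrow> real ^ 4 \<Rightarrow> real ^ 4 \<Rightarrow> ((real ^ 4) \<times> (real ^ 4)) set" where
  "angle_bisector P Q R T =
     (THE C. is_arg_min (\<lambda>C. circle_angle P C (circle_through P Q R))
                        (\<lambda>C. C \<in> equal_angle_circles P Q R T) C)"

text \<open>The point dual to \<open>P\<close> in the quadruplet formed by \<open>P\<close> and \<open>Q, R, T\<close>; the
  definition is symmetric in the last three arguments.\<close>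

definition dual_point :: "real ^ 4 \<Rightarrow> real ^ 4 \<Rightarrow> real ^ 4 \<Rightarrow> real ^ 4 \<Rightarrow> real ^ 4" where
  "dual_point P Q R T = (THE X.
     points (angle_bisector P Q R T) \<inter> points (angle_bisector P R Q T) \<inter>
     points (angle_bisector P T Q R) = {P, X})"

datatype ecomplex = Fin complex | Infty

definition round_2sphere :: "real ^ 4 \<Rightarrow> real \<Rightarrow> real ^ 4 \<Rightarrow> (real ^ 4) set" where
  "round_2sphere c r n = {x \<in> sphere c r. n \<bullet> (x - c) = 0}"

text \<open>Projection from a pole \<open>N\<close> of the 2-sphere onto a plane \<open>a + span {e1, e2}\<close> that
  lies in the hyperplane of the 2-sphere, is parallel to the tangent plane at \<open>N\<close> and does not
  contain \<open>N\<close>. The plane is identified with the complex numbers by the orthonormal frame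
  \<open>e1, e2\<close>, in either orientation. No constraint is imposed on \<open>p\<close> outside the 2-sphere.\<close>

definition stereographic_projection :: "(real ^ 4) set \<Rightarrow> (real ^ 4 \<Rightarrow> ecomplex) \<Rightarrow> bool" where
  "stereographic_projection \<Sigma> p \<longleftrightarrow> (\<exists>c r n N a e1 e2.
     r > 0 \<and> n \<noteq> 0 \<and> \<Sigma> = round_2sphere c r n \<and> N \<in> \<Sigma> \<and>
     norm e1 = 1 \<and> norm e2 = 1 \<and> e1 \<bullet> e2 = 0 \<and>
     n \<bullet> (a - c) = 0 \<and> n \<bullet> e1 = 0 \<and> n \<bullet> e2 = 0 \<and>
     e1 \<bullet> (N - c) = 0 \<and> e2 \<bullet> (N - c) = 0 \<and>
     (\<forall>s t. N \<noteq> a + s *\<^sub>R e1 + t *\<^sub>R e2) \<and>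
     p N = Infty \<and>
     (\<forall>x \<in> \<Sigma> - {N}. \<exists>z. p x = Fin z \<and>
        a + Re z *\<^sub>R e1 + Im z *\<^sub>R e2 \<in> affine hull {N, x}))"

text \<open>The cross ratio is \<open>(z2 - z1) / (z2 - z4) * ((z3 - z4) / (z3 - z1))\<close>. If exactly one argument is
  infinite, the value is the limit; see the lemmas below. With two or more infinite arguments
  (which never happens for distinct points) it is the dummy value 0.\<close>

fun cross_ratio :: "ecomplex \<Rightarrow> ecomplex \<Rightarrow> ecomplex \<Rightarrow> ecomplex \<Rightarrow> complex" where
  "cross_ratio (Fin z1) (Fin z2) (Fin z3) (Fin z4) = (z2 - z1) / (z2 - z4) * ((z3 - z4) / (z3 - z1))"
| "cross_ratio Infty (Fin z2) (Fin z3) (Fin z4) = (z3 - z4) / (z2 - z4)"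
| "cross_ratio (Fin z1) Infty (Fin z3) (Fin z4) = (z3 - z4) / (z3 - z1)"
| "cross_ratio (Fin z1) (Fin z2) Infty (Fin z4) = (z2 - z1) / (z2 - z4)"
| "cross_ratio (Fin z1) (Fin z2) (Fin z3) Infty = (z2 - z1) / (z3 - z1)"
| "cross_ratio _ _ _ _ = 0"

lemma tendsto_quotient_at_infinity:
  fixes a b :: complex
  shows "((\<lambda>z. (z - a) / (z - b)) \<longlongrightarrow> 1) at_infinity"
proof -
  have inf: "filterlim (\<lambda>z. z - b) at_infinity at_infinity"
    using tendsto_add_filterlim_at_infinity'[OF filterlim_ident tendsto_const[of "- b"]] by simp
  have "((\<lambda>z. 1 + (b - a) / (z - b)) \<longlongrightarrow> 1 + 0) at_infinity"
    by (intro tendsto_add tendsto_const tendsto_divide_0[OF tendsto_const inf])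
  moreover have "eventually (\<lambda>z. 1 + (b - a) / (z - b) = (z - a) / (z - b)) at_infinity"
    using eventually_not_equal_at_infinity[of b] by eventually_elim (simp add: field_simps)
  ultimately show ?thesis
    by (simp add: tendsto_cong)
qed

lemma tendsto_quotient_at_infinity':
  fixes a b :: complex
  shows "((\<lambda>z. (a - z) / (b - z)) \<longlongrightarrow> 1) at_infinity"
proof -
  have "(a - z) / (b - z) = (z - a) / (z - b)" for z
    by (metis minus_diff_eq minus_divide_divide)
  then show ?thesis
    using tendsto_quotient_at_infinity[of a b] by simp
qed

lemma cross_ratio_limit_1:
  "((\<lambda>z. cross_ratio (Fin z) (Fin z2) (Fin z3) (Fin z4)) \<longlongrightarrow>
      cross_ratio Infty (Fin z2) (Fin z3) (Fin z4)) at_infinity"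
  using tendsto_mult[OF tendsto_const[of "(z3 - z4) / (z2 - z4)"]
    tendsto_quotient_at_infinity'[of z2 z3]] by (simp add: mult.commute)

lemma cross_ratio_limit_2:
  "((\<lambda>z. cross_ratio (Fin z1) (Fin z) (Fin z3) (Fin z4)) \<longlongrightarrow>
      cross_ratio (Fin z1) Infty (Fin z3) (Fin z4)) at_infinity"
  using tendsto_mult[OF tendsto_quotient_at_infinity[of z1 z4]
    tendsto_const[of "(z3 - z4) / (z3 - z1)"]] by simp

lemma cross_ratio_limit_3:
  "((\<lambda>z. cross_ratio (Fin z1) (Fin z2) (Fin z) (Fin z4)) \<longlongrightarrow>
      cross_ratio (Fin z1) (Fin z2) Infty (Fin z4)) at_infinity"
  using tendsto_mult[OF tendsto_const[of "(z2 - z1) / (z2 - z4)"]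
    tendsto_quotient_at_infinity[of z4 z1]] by simp

lemma cross_ratio_limit_4:
  "((\<lambda>z. cross_ratio (Fin z1) (Fin z2) (Fin z3) (Fin z)) \<longlongrightarrow>
      cross_ratio (Fin z1) (Fin z2) (Fin z3) Infty) at_infinity"
  using tendsto_mult[OF tendsto_const[of "(z2 - z1) / (z3 - z1)"]
    tendsto_quotient_at_infinity'[of z3 z2]] by (simp add: mult.commute)

end

theory Submission
  imports Defs
begin

text \<open>
  Inversion at \<open>P\<close> maps the 3-sphere without \<open>P\<close> to a Euclidean hyperplane, the oriented circles
  through \<open>P\<close> to oriented lines, and it preserves angles at \<open>P\<close>. So the circular angle bisectors
  become the interior angle bisectors of the triangle of the three inverted points, and the point
  dual to \<open>P\<close> is the inverse image of the incenter (\<open>flip_dual_point\<close>). The incenter is an affine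
  combination whose weights are the side lengths, and inversion divides the distance of \<open>x\<close> and \<open>y\<close>
  by \<open>|x - P| |y - P|\<close>. Thus the weight of \<open>Q\<close> is proportional to \<open>|Q - P| |R - T|\<close>, where \<open>R, T\<close>
  are the other two points.

  The image of a point under a stereographic projection is written in homogeneous coordinates in
  \<open>\<complex>\<^sup>2\<close>, which covers the pole as well. Let \<open>v\<^sub>i\<close> be the coordinates of \<open>P\<^sub>i\<close> and
  \<open>d\<^sub>i\<^sub>j = det (v\<^sub>i, v\<^sub>j)\<close>. The number \<open>|det|\<close> of two points is their distance times a factor for each
  of the points (\<open>stereographic_chordal_metric\<close>). Consequently \<open>x \<mapsto> v\<^sub>x / det (v\<^sub>x, v\<^sub>1)\<close>
  agrees with inversion at \<open>P\<^sub>1\<close> up to a similarity, and since similarities preserve affine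
  combinations, the dual point of \<open>P\<^sub>1\<close> has the homogeneous coordinates
  \<open>w\<^sub>1 = \<Sum>\<^sub>j |d\<^sub>1\<^sub>j| |d\<^sub>k\<^sub>l| v\<^sub>j / d\<^sub>j\<^sub>1\<close> with \<open>{1, j, k, l} = {1, 2, 3, 4}\<close> (\<open>homog_dual_point\<close>).

  The rest is algebra. By the Pluecker relation
  \<open>d\<^sub>1\<^sub>2 d\<^sub>3\<^sub>4 + d\<^sub>1\<^sub>3 d\<^sub>4\<^sub>2 + d\<^sub>1\<^sub>4 d\<^sub>2\<^sub>3 = 0\<close> and \<open>|x|\<^sup>2 / x = cnj x\<close>, the determinant of two dual vectors
  collapses to \<open>det (w\<^sub>i, w\<^sub>j) = 2 s |d\<^sub>i\<^sub>j d\<^sub>k\<^sub>l| / d\<^sub>i\<^sub>j\<close> with the same real \<open>s\<close> for all pairs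
  (\<open>wedge_dual_vector\<close>). The cross ratio contains each pair together with the complementary one,
  so it becomes a quotient of two terms \<open>|x|\<^sup>2 / x = cnj x\<close>, which is the conjugate of the
  original cross ratio.
\<close>

section \<open>Inversion at a point\<close>

text \<open>Inversion in the unit sphere around \<open>P\<close>, followed by the translation of \<open>P\<close> to the origin. The
  division conventions give \<open>flip P P = 0\<close> and \<open>unflip P 0 = P\<close>, so that the two maps are mutually
  inverse on the whole space.\<close>

definition flip :: "'a::real_inner \<Rightarrow> 'a \<Rightarrow> 'a" where
  "flip P x = (x - P) /\<^sub>R (norm (x - P))\<^sup>2"

definition unflip :: "'a::real_inner \<Rightarrow> 'a \<Rightarrow> 'a" where
  "unflip P y = P + y /\<^sub>R (norm y)\<^sup>2"

lemma flip_unflip [simp]: "flip P (unflip P y) = y"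
  by (cases "y = 0") (auto simp: flip_def unflip_def power2_eq_square field_simps)

lemma unflip_flip [simp]: "unflip P (flip P x) = x"
proof -
  have "unflip P (flip P (P + d)) = P + d" for d
    by (cases "d = 0") (auto simp: flip_def unflip_def power2_eq_square field_simps)
  from this[of "x - P"] show ?thesis by simp
qed

lemma inj_unflip: "inj (unflip P)"
  by (metis flip_unflip injI)

lemma norm_flip_diff:
  assumes "x \<noteq> P" "y \<noteq> P"
  shows "norm (flip P x - flip P y) = norm (x - y) / (norm (x - P) * norm (y - P))"
proof -
  define a b where "a = x - P" and "b = y - P"
  have ne: "norm a \<noteq> 0" "norm b \<noteq> 0" using assms by (auto simp: a_def b_def)
  have "(norm (flip P x - flip P y))\<^sup>2 = (norm (a /\<^sub>R (norm a)\<^sup>2 - b /\<^sub>R (norm b)\<^sup>2))\<^sup>2"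
    by (simp add: flip_def a_def b_def)
  also have "\<dots> = (norm (a - b) / (norm a * norm b))\<^sup>2"
    using ne unfolding power_divide power_mult_distrib
    by (simp only: power2_norm_eq_inner inner_diff_left inner_diff_right)
       (simp add: field_simps inner_commute dot_square_norm power2_eq_square)
  finally show ?thesis
    by (simp add: a_def b_def)
qed

text \<open>Expanding \<open>|x - c|\<^sup>2 = |(x - P) + (P - c)|\<^sup>2\<close> turns the equation of a sphere through \<open>P\<close> into an
  affine equation for the inverted point.\<close>

lemma flip_inner_sphere:
  assumes "norm (P - c) = r" "x \<noteq> P"
  shows "norm (x - c) = r \<longleftrightarrow> flip P x \<bullet> (P - c) = - 1 / 2"
proof -
  have *: "norm (x - P) \<noteq> 0" using assms by simp
  have "norm (x - c) = r \<longleftrightarrow> (norm (x - c))\<^sup>2 = (norm (P - c))\<^sup>2"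
    using assms(1) by (metis norm_ge_zero power2_eq_iff_nonneg)
  also have "\<dots> \<longleftrightarrow> 2 * ((x - P) \<bullet> (P - c)) = - (norm (x - P))\<^sup>2"
    unfolding power2_norm_eq_inner by (auto simp: algebra_simps inner_commute)
  also have "\<dots> \<longleftrightarrow> flip P x \<bullet> (P - c) = - 1 / 2"
    using * by (simp only: flip_def inner_scaleR_left) (auto simp: field_simps)
  finally show ?thesis .
qed

lemma flip_inner_S3:
  assumes "P \<in> S3" "x \<in> S3" "x \<noteq> P"
  shows "flip P x \<bullet> P = - 1 / 2"
  using flip_inner_sphere[of P 0 1 x] assms by simp

section \<open>Circles through the centre of inversion\<close>

text \<open>The squared norm of the point at parameter \<open>t\<close> is a trigonometric polynomial of degree one in
  \<open>t\<close>; it is constant iff \<open>c\<close> is orthogonal to the plane of the circle.\<close>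

lemma circle_frame_iff:
  "circle_frame c r u v \<longleftrightarrow>
     r > 0 \<and> norm u = 1 \<and> norm v = 1 \<and> u \<bullet> v = 0 \<and> c \<bullet> u = 0 \<and> c \<bullet> v = 0 \<and> (norm c)\<^sup>2 + r\<^sup>2 = 1"
proof -
  have expand: "(norm (circle_point c r u v t))\<^sup>2 =
      (norm c)\<^sup>2 + r\<^sup>2 + 2 * r * cos t * (c \<bullet> u) + 2 * r * sin t * (c \<bullet> v)"
    if "norm u = 1" "norm v = 1" "u \<bullet> v = 0" for t
  proof -
    have "u \<bullet> u = 1" "v \<bullet> v = 1" "v \<bullet> u = 0"
      using that by (auto simp: norm_eq_1 inner_commute)
    then have "(norm (circle_point c r u v t))\<^sup>2 = (norm c)\<^sup>2 + (r\<^sup>2 * (cos t)\<^sup>2 + r\<^sup>2 * (sin t)\<^sup>2)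
        + 2 * r * cos t * (c \<bullet> u) + 2 * r * sin t * (c \<bullet> v)"
      using that(3) unfolding power2_norm_eq_inner circle_point_def
      by (simp add: inner_commute algebra_simps power2_eq_square)
    then show ?thesis by (simp flip: distrib_left)
  qed
  have S3_iff: "x \<in> S3 \<longleftrightarrow> (norm x)\<^sup>2 = 1" for x
    by (simp add: power2_eq_1_iff) (metis norm_ge_zero neg_0_le_iff_le not_one_le_zero)
  show ?thesis
  proof
    assume f: "circle_frame c r u v"
    then have r: "r > 0" and u: "norm u = 1" "norm v = 1" "u \<bullet> v = 0"
      and *: "\<And>t. (norm (circle_point c r u v t))\<^sup>2 = 1"
      unfolding circle_frame_def S3_iff by auto
    note eq = *[unfolded expand[OF u]]
    have "r * (c \<bullet> u) = 0" using eq[of 0, simplified] eq[of pi, simplified] by linarith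
    then have cu: "c \<bullet> u = 0" using r by simp
    have "r * (c \<bullet> v) = 0"
      using eq[of "pi/2", simplified] eq[of "-pi/2", simplified] by linarith
    then have cv: "c \<bullet> v = 0" using r by simp
    show "r > 0 \<and> norm u = 1 \<and> norm v = 1 \<and> u \<bullet> v = 0 \<and> c \<bullet> u = 0 \<and> c \<bullet> v = 0 \<and> (norm c)\<^sup>2 + r\<^sup>2 = 1"
      using r u cu cv eq[of 0] by simp
  next
    assume "r > 0 \<and> norm u = 1 \<and> norm v = 1 \<and> u \<bullet> v = 0 \<and> c \<bullet> u = 0 \<and> c \<bullet> v = 0 \<and> (norm c)\<^sup>2 + r\<^sup>2 = 1"
    then show "circle_frame c r u v"
      unfolding circle_frame_def S3_iff by (simp add: expand)
  qed
qed

lemma rebase_circle: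
  fixes t0 :: real
  assumes "circle_frame c r u v"
  defines "u' \<equiv> cos t0 *\<^sub>R u + sin t0 *\<^sub>R v" and "v' \<equiv> circle_tangent u v t0"
  shows "circle_frame c r u' v'"
    and "circle_point c r u' v' t = circle_point c r u v (t + t0)"
    and "oriented_circle c r u' v' = oriented_circle c r u v"
proof -
  have f: "u \<bullet> u = 1" "v \<bullet> v = 1" "v \<bullet> u = 0" "u \<bullet> v = 0" "c \<bullet> u = 0" "c \<bullet> v = 0"
      "r > 0" "(norm c)\<^sup>2 + r\<^sup>2 = 1"
    using assms(1) unfolding circle_frame_iff by (auto simp: norm_eq_1 inner_commute)
  show "circle_frame c r u' v'"
    unfolding circle_frame_iff u'_def v'_def circle_tangent_def norm_eq_1
    using f by (simp add: inner_add_left inner_add_right inner_diff_left inner_diff_right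
        flip: power2_eq_square)
  have pt: "circle_point c r u' v' t = circle_point c r u v (t + t0)" for t
    by (simp add: circle_point_def circle_tangent_def u'_def v'_def cos_add sin_add algebra_simps)
  then show "circle_point c r u' v' t = circle_point c r u v (t + t0)" .
  have tg: "circle_tangent u' v' t = circle_tangent u v (t + t0)" for t
    by (simp add: circle_tangent_def u'_def v'_def cos_add sin_add algebra_simps)
  have "oriented_circle c r u' v' =
      (\<lambda>t. (circle_point c r u v t, circle_tangent u v t)) ` range (\<lambda>t. t + t0)"
    unfolding oriented_circle_def pt tg by (simp only: image_image)
  moreover have "range (\<lambda>t. t + t0) = UNIV" by (metis surjI diff_add_cancel)
  ultimately show "oriented_circle c r u' v' = oriented_circle c r u v"
    by (simp only: oriented_circle_def)
qed

text \<open>With the base point \<open>P = c + r u\<close> at parameter \<open>0\<close>, the circle becomes a line directed by its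
  tangent vector \<open>v\<close> at \<open>P\<close>. The coordinate \<open>cot (t / 2) / (2 r)\<close> decreases with \<open>t\<close>, so the line is
  run through in the direction \<open>- v\<close>.\<close>

lemma flip_circle_point:
  assumes "circle_frame c r u v" "sin (t / 2) \<noteq> 0"
  shows "flip (c + r *\<^sub>R u) (circle_point c r u v t) =
     (- 1 / (2 * r)) *\<^sub>R u + (cot (t / 2) / (2 * r)) *\<^sub>R v"
proof -
  define s k where "s = sin (t / 2)" and "k = cos (t / 2)"
  have f: "u \<bullet> u = 1" "v \<bullet> v = 1" "v \<bullet> u = 0" "u \<bullet> v = 0" "r > 0"
    using assms(1) unfolding circle_frame_iff by (auto simp: norm_eq_1 inner_commute)
  have s: "s \<noteq> 0" "k\<^sup>2 + s\<^sup>2 = 1" using assms(2) by (auto simp: s_def k_def)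
  have "cos t = 1 - 2 * s\<^sup>2" "sin t = 2 * s * k"
    using cos_double_sin[of "t/2"] sin_double[of "t/2"] by (auto simp: s_def k_def)
  then have d: "circle_point c r u v t - (c + r *\<^sub>R u) = (2 * r * s) *\<^sub>R (k *\<^sub>R v - s *\<^sub>R u)"
    by (simp add: circle_point_def scaleR_diff_right scaleR_diff_left left_diff_distrib
        right_diff_distrib power2_eq_square mult_ac)
  have "(norm (k *\<^sub>R v - s *\<^sub>R u))\<^sup>2 = 1"
    unfolding power2_norm_eq_inner using f s(2)
    by (simp add: inner_diff_left inner_diff_right power2_eq_square)
  then have "flip (c + r *\<^sub>R u) (circle_point c r u v t) =
     (1 / (2 * r * s)) *\<^sub>R (k *\<^sub>R v - s *\<^sub>R u)"
    using f(5) s(1) unfolding flip_def d norm_scaleR power_mult_distrib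
    by (simp add: power2_eq_square field_simps del: scaleR_diff_right)
  then show ?thesis using f(5) s(1)
    by (simp add: cot_def s_def[symmetric] k_def[symmetric] algebra_simps)
qed

lemma circle_point_base:
  assumes "sin (t / 2) = 0"
  shows "circle_point c r u v t = c + r *\<^sub>R u" "circle_tangent u v t = v"
proof -
  have "cos t = 1" "sin t = 0"
    using cos_double_sin[of "t/2"] sin_double[of "t/2"] assms by auto
  then show "circle_point c r u v t = c + r *\<^sub>R u" "circle_tangent u v t = v"
    by (auto simp: circle_point_def circle_tangent_def)
qed

lemma cot_surj:
  fixes s :: real
  defines "t \<equiv> pi - 2 * arctan s"
  shows "0 < t" "t < 2 * pi" "sin (t / 2) > 0" "cot (t / 2) = s"
proof -
  have h: "t / 2 = pi / 2 - arctan s" by (simp add: t_def field_simps)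
  show "0 < t" "t < 2 * pi"
    using arctan_lbound[of s] arctan_ubound[of s] by (auto simp: t_def)
  show "sin (t / 2) > 0" "cot (t / 2) = s"
    unfolding h cot_def using cos_arctan_not_zero[of s] arctan_bounded[of s] tan_arctan[of s]
    by (simp_all add: sin_diff cos_diff tan_def cos_gt_zero_pi del: tan_arctan)
qed

lemma points_based_circle:
  assumes "circle_frame c r u v"
  defines "P \<equiv> c + r *\<^sub>R u"
  shows "points (oriented_circle c r u v) =
    insert P (range (\<lambda>s. unflip P ((- 1 / (2 * r)) *\<^sub>R u + s *\<^sub>R v)))"
proof -
  have r: "r > 0" using assms(1) by (simp add: circle_frame_iff)
  have pts: "points (oriented_circle c r u v) = range (circle_point c r u v)"
    by (auto simp: points_def oriented_circle_def image_image)
  note fl = flip_circle_point[OF assms(1), folded P_def]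
  show ?thesis unfolding pts
  proof (intro equalityI subsetI)
    fix x assume "x \<in> range (circle_point c r u v)"
    then obtain t where x: "x = circle_point c r u v t" by auto
    show "x \<in> insert P (range (\<lambda>s. unflip P ((- 1 / (2 * r)) *\<^sub>R u + s *\<^sub>R v)))"
    proof (cases "sin (t / 2) = 0")
      case False
      from fl[OF this] x
      have "x = unflip P ((- 1 / (2 * r)) *\<^sub>R u + (cot (t / 2) / (2 * r)) *\<^sub>R v)"
        by (metis unflip_flip)
      then show ?thesis by blast
    qed (simp add: x circle_point_base P_def)
  next
    fix x assume "x \<in> insert P (range (\<lambda>s. unflip P ((- 1 / (2 * r)) *\<^sub>R u + s *\<^sub>R v)))"
    then consider "x = P" | s where "x = unflip P ((- 1 / (2 * r)) *\<^sub>R u + s *\<^sub>R v)" by auto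
    then show "x \<in> range (circle_point c r u v)"
    proof cases
      case 1
      then show ?thesis using circle_point_base(1)[of 0 c r u v] unfolding P_def by (metis div_0 rangeI sin_zero)
    next
      case 2
      define t where "t = pi - 2 * arctan (2 * r * s)"
      have "sin (t / 2) \<noteq> 0" "cot (t / 2) = 2 * r * s"
        using cot_surj[of "2 * r * s"] unfolding t_def by auto
      with fl[of t] r have "flip P (circle_point c r u v t) = (- 1 / (2 * r)) *\<^sub>R u + s *\<^sub>R v" by simp
      with 2 have "x = circle_point c r u v t" by (metis unflip_flip)
      then show ?thesis by blast
    qed
  qed
qed

text \<open>The description in \<^const>\<open>pos_tangent\<close> is meaningful because the circle passes through its base
  point only once per period.\<close>

lemma pos_tangent_based_circle:
  assumes "circle_frame c r u v"
  shows "pos_tangent (oriented_circle c r u v) (c + r *\<^sub>R u) = v"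
proof -
  have r: "r > 0" and uv: "u \<bullet> v = 0" "u \<bullet> u = 1"
    using assms by (auto simp: circle_frame_iff norm_eq_1)
  have "w = v" if w: "(c + r *\<^sub>R u, w) \<in> oriented_circle c r u v" for w
  proof -
    obtain t where t: "c + r *\<^sub>R u = circle_point c r u v t" "w = circle_tangent u v t"
      using w unfolding oriented_circle_def by blast
    have "u \<bullet> circle_point c r u v t = u \<bullet> (c + r *\<^sub>R u)" using t by simp
    then have "cos t = 1" using r uv by (simp add: circle_point_def inner_add_right)
    moreover then have "sin t = 0" using sin_cos_squared_add[of t] by simp
    ultimately show "w = v" using t by (simp add: circle_tangent_def)
  qed
  moreover have "(c + r *\<^sub>R u, v) \<in> oriented_circle c r u v"
    using circle_point_base(1)[of 0 c r u v] circle_point_base(2)[of 0 u v] unfolding oriented_circle_def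
    by (auto intro!: rev_image_eqI[of 0])
  ultimately show ?thesis unfolding pos_tangent_def by (rule the_equality[rotated])
qed

section \<open>Oriented circles through two points of the 3-sphere\<close>

text \<open>The oriented circle through \<open>P\<close> and \<open>Q\<close> with unit tangent vector \<open>v\<close> at \<open>P\<close>. Inversion at \<open>P\<close>
  maps it to the line through \<open>flip P Q\<close> with direction \<open>v\<close>; \<open>m\<close> is the foot of the perpendicular
  from the origin to that line, and centre and radius are those of the inverse image.\<close>

definition pencil_circle ::
    "real ^ 4 \<Rightarrow> real ^ 4 \<Rightarrow> real ^ 4 \<Rightarrow> ((real ^ 4) \<times> (real ^ 4)) set" where
  "pencil_circle P Q v = (let m = flip P Q - (flip P Q \<bullet> v) *\<^sub>R v in
     oriented_circle (P + m /\<^sub>R (2 * (norm m)\<^sup>2)) (1 / (2 * norm m)) (- sgn m) v)"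

text \<open>So an oriented circle through \<open>P\<close> and \<open>Q\<close> is determined by its tangent vector at \<open>P\<close>; this gives
  the uniqueness of the circles that are defined by definite descriptions.\<close>

lemma based_circle_as_pencil:
  assumes f: "circle_frame c r u v" and P: "P = c + r *\<^sub>R u"
    and Q: "Q \<in> points (oriented_circle c r u v)" "Q \<noteq> P"
  shows "oriented_circle c r u v = pencil_circle P Q v"
    and "points (oriented_circle c r u v) = insert P (range (\<lambda>s. unflip P (flip P Q + s *\<^sub>R v)))"
    and "\<exists>s. flip P Q = (- 1 / (2 * r)) *\<^sub>R u + s *\<^sub>R v"
proof -
  have uv: "norm u = 1" "v \<bullet> v = 1" "u \<bullet> v = 0" "r > 0"
    using f by (auto simp: circle_frame_iff norm_eq_1)
  note pts = points_based_circle[OF f, folded P]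
  obtain s where "Q = unflip P ((- 1 / (2 * r)) *\<^sub>R u + s *\<^sub>R v)"
    using Q pts by auto
  then have s: "flip P Q = (- 1 / (2 * r)) *\<^sub>R u + s *\<^sub>R v" by simp
  then show "\<exists>s. flip P Q = (- 1 / (2 * r)) *\<^sub>R u + s *\<^sub>R v" ..
  define m where "m = flip P Q - (flip P Q \<bullet> v) *\<^sub>R v"
  have m: "m = (- 1 / (2 * r)) *\<^sub>R u" using uv by (simp add: m_def s inner_diff_left)
  have nm: "norm m = 1 / (2 * r)" "1 / (2 * norm m) = r" using uv by (auto simp: m)
  have "sgn m = - u" using uv unfolding sgn_div_norm nm by (simp add: m)
  moreover have "P + m /\<^sub>R (2 * (norm m)\<^sup>2) = c"
    unfolding nm P m using uv by (simp add: power2_eq_square field_simps)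
  ultimately show "oriented_circle c r u v = pencil_circle P Q v"
    unfolding pencil_circle_def m_def[symmetric] Let_def nm(2) by simp
  have "range (\<lambda>s. (- 1 / (2 * r)) *\<^sub>R u + s *\<^sub>R v) = range (\<lambda>s. flip P Q + s *\<^sub>R v)"
  proof (intro equalityI subsetI; elim rangeE)
    fix y t assume "y = (- 1 / (2 * r)) *\<^sub>R u + t *\<^sub>R v"
    then have "y = flip P Q + (t - s) *\<^sub>R v" by (simp add: s algebra_simps)
    then show "y \<in> range (\<lambda>s. flip P Q + s *\<^sub>R v)" by blast
  next
    fix y t assume "y = flip P Q + t *\<^sub>R v"
    then have "y = (- 1 / (2 * r)) *\<^sub>R u + (t + s) *\<^sub>R v" by (simp add: s algebra_simps)
    then show "y \<in> range (\<lambda>s. (- 1 / (2 * r)) *\<^sub>R u + s *\<^sub>R v)" by blast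
  qed
  then have "unflip P ` range (\<lambda>s. (- 1 / (2 * r)) *\<^sub>R u + s *\<^sub>R v) =
      unflip P ` range (\<lambda>s. flip P Q + s *\<^sub>R v)" by (rule arg_cong)
  then show "points (oriented_circle c r u v) = insert P (range (\<lambda>s. unflip P (flip P Q + s *\<^sub>R v)))"
    unfolding pts by (simp only: image_image)
qed

text \<open>Inverted points of the 3-sphere lie in the hyperplane \<open>y \<bullet> P = - 1 / 2\<close>. Hence \<open>m \<noteq> 0\<close>, and the radius
  in \<^const>\<open>pencil_circle\<close> is a proper one.\<close>

lemma pencil_circle_frame:
  assumes P: "P \<in> S3" and Q: "Q \<in> S3" "Q \<noteq> P" and v: "norm v = 1" "v \<bullet> P = 0"
  obtains c r u where "circle_frame c r u v" "P = c + r *\<^sub>R u"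
    "Q \<in> points (oriented_circle c r u v)" "pencil_circle P Q v = oriented_circle c r u v"
proof -
  define m where "m = flip P Q - (flip P Q \<bullet> v) *\<^sub>R v"
  have mP: "m \<bullet> P = - 1 / 2"
    using flip_inner_S3[OF P Q] v by (simp add: m_def inner_diff_left)
  then have nz: "m \<noteq> 0" by auto
  have mv: "m \<bullet> v = 0" using v by (simp add: m_def inner_diff_left norm_eq_1)
  define c r u where "c = P + m /\<^sub>R (2 * (norm m)\<^sup>2)" and "r = 1 / (2 * norm m)" and "u = - sgn m"
  have m_u: "m = (- 1 / (2 * r)) *\<^sub>R u"
    using nz by (simp add: r_def u_def sgn_div_norm)
  have Pc: "P = c + r *\<^sub>R u"
    by (simp add: c_def r_def u_def sgn_div_norm inverse_eq_divide power2_eq_square)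
  have PP: "P \<bullet> P = 1" using P by (simp add: norm_eq_1)
  have mm: "m \<bullet> m = (norm m)\<^sup>2" by (simp add: dot_square_norm)
  have "circle_frame c r u v" unfolding circle_frame_iff
  proof (intro conjI)
    show "r > 0" "norm u = 1" "norm v = 1" using nz v by (auto simp: r_def u_def norm_sgn)
    show "u \<bullet> v = 0" using mv by (simp add: u_def sgn_div_norm)
    have "c \<bullet> m = 0" using nz mP
      by (simp add: c_def inner_add_left mm inner_commute[of P m])
    then show "c \<bullet> u = 0" by (simp add: u_def sgn_div_norm)
    show "c \<bullet> v = 0" using v mv by (simp add: c_def inner_add_left inner_commute[of P v])
    show "(norm c)\<^sup>2 + r\<^sup>2 = 1"
      using nz unfolding c_def r_def power2_norm_eq_inner[of "P + _"]
      by (simp add: inner_add_left inner_add_right PP mP mm inner_commute[of P m] field_simps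
          power2_eq_square)
  qed
  moreover have "pencil_circle P Q v = oriented_circle c r u v"
    by (simp add: pencil_circle_def Let_def c_def r_def u_def flip: m_def)
  moreover have "flip P Q = (- 1 / (2 * r)) *\<^sub>R u + (flip P Q \<bullet> v) *\<^sub>R v"
    unfolding m_u[symmetric] by (simp add: m_def)
  then have "Q = unflip P ((- 1 / (2 * r)) *\<^sub>R u + (flip P Q \<bullet> v) *\<^sub>R v)"
    by (metis unflip_flip)
  then have "Q \<in> points (oriented_circle c r u v)"
    unfolding points_based_circle[OF calculation(1)] Pc[symmetric] by blast
  ultimately show ?thesis using that Pc by blast
qed

lemma pencil_circle:
  assumes "P \<in> S3" "Q \<in> S3" "Q \<noteq> P" "norm v = 1" "v \<bullet> P = 0"
  shows "pencil_circle P Q v \<in> oriented_circles"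
    and "points (pencil_circle P Q v) = insert P (range (\<lambda>s. unflip P (flip P Q + s *\<^sub>R v)))"
    and "pos_tangent (pencil_circle P Q v) P = v"
proof -
  obtain c r u where *: "circle_frame c r u v" "P = c + r *\<^sub>R u"
    "Q \<in> points (oriented_circle c r u v)" "pencil_circle P Q v = oriented_circle c r u v"
    using pencil_circle_frame[OF assms] by blast
  show "pencil_circle P Q v \<in> oriented_circles"
    using * by (auto simp: oriented_circles_def)
  show "points (pencil_circle P Q v) = insert P (range (\<lambda>s. unflip P (flip P Q + s *\<^sub>R v)))"
    unfolding *(4) by (rule based_circle_as_pencil(2)[OF *(1,2,3) assms(3)])
  show "pos_tangent (pencil_circle P Q v) P = v"
    using pos_tangent_based_circle[OF *(1), folded *(2)] *(4) by simp
qed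

lemma frame_tangent_orthogonal:
  assumes "circle_frame c r u v"
  shows "norm v = 1" "v \<bullet> (c + r *\<^sub>R u) = 0"
  using assms by (auto simp: circle_frame_iff inner_add_right inner_commute)

text \<open>Hence the oriented circles through \<open>P\<close> and \<open>Q\<close> are parametrised by the unit vectors tangent to
  the 3-sphere at \<open>P\<close>, and minimising angles becomes a problem about unit vectors.\<close>

lemma circles_through_two_points:
  assumes "P \<in> S3" "Q \<in> S3" "Q \<noteq> P"
  shows "C \<in> oriented_circles \<and> P \<in> points C \<and> Q \<in> points C \<longleftrightarrow>
    (\<exists>v. norm v = 1 \<and> v \<bullet> P = 0 \<and> C = pencil_circle P Q v)"
proof
  assume C: "C \<in> oriented_circles \<and> P \<in> points C \<and> Q \<in> points C"
  then obtain c r u v where f: "circle_frame c r u v" and Cf: "C = oriented_circle c r u v"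
    by (auto simp: oriented_circles_def)
  obtain t where t: "P = circle_point c r u v t"
    using C Cf by (auto simp: points_def oriented_circle_def)
  \<comment> \<open>Shift the parameter so that the circle starts at \<open>P\<close>.\<close>
  define u' v' where "u' = cos t *\<^sub>R u + sin t *\<^sub>R v" and "v' = circle_tangent u v t"
  note rb = rebase_circle[OF f, of t, folded u'_def v'_def]
  have P: "P = c + r *\<^sub>R u'" using rb(2)[of 0] t circle_point_base(1)[of 0 c r u' v'] by simp
  have "Q \<in> points (oriented_circle c r u' v')" using C Cf rb(3) by simp
  from based_circle_as_pencil(1)[OF rb(1) P this assms(3)] rb(3) Cf
  have "C = pencil_circle P Q v'" by simp
  then show "\<exists>v. norm v = 1 \<and> v \<bullet> P = 0 \<and> C = pencil_circle P Q v"
    using frame_tangent_orthogonal[OF rb(1), folded P] by blast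
next
  assume "\<exists>v. norm v = 1 \<and> v \<bullet> P = 0 \<and> C = pencil_circle P Q v"
  then obtain v where v: "norm v = 1" "v \<bullet> P = 0" "C = pencil_circle P Q v" by blast
  have "unflip P (flip P Q + 0 *\<^sub>R v) = Q" by simp
  then show "C \<in> oriented_circles \<and> P \<in> points C \<and> Q \<in> points C"
    unfolding v(3) using pencil_circle[OF assms v(1,2)] by (metis insertI1 insertI2 rangeI)
qed

lemma cot_half_less:
  fixes s t :: real
  assumes "0 < s" "s < t" "t < 2 * pi"
  shows "cot (t / 2) < cot (s / 2)"
proof -
  have *: "sin (s / 2) > 0" "sin (t / 2) > 0" "sin (t / 2 - s / 2) > 0"
    using assms by (auto intro!: sin_gt_zero)
  then have "cos (t / 2) * sin (s / 2) < cos (s / 2) * sin (t / 2)"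
    unfolding sin_diff by (simp add: mult.commute)
  with * show ?thesis
    by (simp add: cot_def field_simps)
qed

lemma sgn_flip_diff_tangent:
  assumes "P \<in> S3" "Q \<in> S3" "R \<in> S3" "Q \<noteq> P" "R \<noteq> P" "R \<noteq> Q"
  shows "norm (sgn (flip P Q - flip P R)) = 1" "sgn (flip P Q - flip P R) \<bullet> P = 0"
proof -
  have "flip P Q \<noteq> flip P R" using assms(6) by (metis unflip_flip)
  then show "norm (sgn (flip P Q - flip P R)) = 1" by (simp add: norm_sgn)
  show "sgn (flip P Q - flip P R) \<bullet> P = 0"
    using flip_inner_S3 assms by (simp add: sgn_div_norm inner_diff_left)
qed

text \<open>After inversion at \<open>P\<close> the cyclic order \<open>P \<rightarrow> Q \<rightarrow> R\<close> says that the line is run through from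
  \<open>flip P Q\<close> to \<open>flip P R\<close>. As the line is run through against the tangent vector at \<open>P\<close>, this
  vector points from \<open>flip P R\<close> to \<open>flip P Q\<close>.\<close>

lemma circle_through_eq_pencil:
  assumes S: "P \<in> S3" "Q \<in> S3" "R \<in> S3" and ne: "Q \<noteq> P" "R \<noteq> P" "R \<noteq> Q"
  shows "circle_through P Q R = pencil_circle P Q (sgn (flip P Q - flip P R))"
  unfolding circle_through_def
proof (rule the_equality)
  define v where "v = sgn (flip P Q - flip P R)"
  note v = sgn_flip_diff_tangent[OF assms, folded v_def]
  obtain c r u where f: "circle_frame c r u v" "P = c + r *\<^sub>R u"
    "Q \<in> points (oriented_circle c r u v)" "pencil_circle P Q v = oriented_circle c r u v"
    using pencil_circle_frame[OF S(1,2) ne(1) v] by blast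
  have r: "r > 0" using f by (simp add: circle_frame_iff)
  obtain s where s: "flip P Q = (- 1 / (2 * r)) *\<^sub>R u + s *\<^sub>R v"
    using based_circle_as_pencil(3)[OF f(1,2,3) ne(1)] by blast
  \<comment> \<open>The position of \<open>flip P R\<close> on the line through \<open>flip P Q\<close>; the parameters of both points come from \<open>cot_surj\<close>.\<close>
  define s' where "s' = s - norm (flip P Q - flip P R)"
  have "norm (flip P Q - flip P R) *\<^sub>R v = flip P Q - flip P R"
    by (cases "flip P Q = flip P R") (simp_all add: v_def sgn_div_norm)
  then have R: "flip P R = (- 1 / (2 * r)) *\<^sub>R u + s' *\<^sub>R v"
    by (simp add: s'_def scaleR_diff_left s)
  have lt: "2 * r * s' < 2 * r * s"
    using r ne by (simp add: s'_def) (metis unflip_flip)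
  have pt: "circle_point c r u v (pi - 2 * arctan (2 * r * x)) = X"
    if "flip P X = (- 1 / (2 * r)) *\<^sub>R u + x *\<^sub>R v" for x X
    using flip_circle_point[OF f(1), of "pi - 2 * arctan (2 * r * x)", folded f(2)]
      cot_surj[of "2 * r * x"] r that by (metis (no_types, lifting) less_irrefl unflip_flip
        nonzero_mult_div_cancel_left zero_less_mult_iff zero_less_numeral)
  show "\<exists>c r u v' t1 t2 t3.
     circle_frame c r u v' \<and> pencil_circle P Q v = oriented_circle c r u v' \<and>
     t1 < t2 \<and> t2 < t3 \<and> t3 < t1 + 2 * pi \<and>
     P = circle_point c r u v' t1 \<and> Q = circle_point c r u v' t2 \<and> R = circle_point c r u v' t3"
    using f lt pt[OF s] pt[OF R] cot_surj[of "2 * r * s"] cot_surj[of "2 * r * s'"]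
      circle_point_base(1)[of 0 c r u v]
    by (intro exI[of _ c] exI[of _ r] exI[of _ u] exI[of _ v] exI[of _ 0]
        exI[of _ "pi - 2 * arctan (2 * r * s)"] exI[of _ "pi - 2 * arctan (2 * r * s')"])
       (simp add: arctan_less_iff)
next
  fix C assume "\<exists>c r u v t1 t2 t3.
     circle_frame c r u v \<and> C = oriented_circle c r u v \<and>
     t1 < t2 \<and> t2 < t3 \<and> t3 < t1 + 2 * pi \<and>
     P = circle_point c r u v t1 \<and> Q = circle_point c r u v t2 \<and> R = circle_point c r u v t3"
  then obtain c r u v t1 t2 t3 where f: "circle_frame c r u v" and C: "C = oriented_circle c r u v"
    and t: "t1 < t2" "t2 < t3" "t3 < t1 + 2 * pi"
    and pt: "P = circle_point c r u v t1" "Q = circle_point c r u v t2" "R = circle_point c r u v t3"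
    by blast
  define u' v' where "u' = cos t1 *\<^sub>R u + sin t1 *\<^sub>R v" and "v' = circle_tangent u v t1"
  note rb = rebase_circle[OF f, of t1, folded u'_def v'_def]
  have P: "P = c + r *\<^sub>R u'" using rb(2)[of 0] pt circle_point_base(1)[of 0 c r u' v'] by simp
  have Q: "Q = circle_point c r u' v' (t2 - t1)" and R: "R = circle_point c r u' v' (t3 - t1)"
    using rb(2) pt by auto
  have r: "r > 0" using f by (simp add: circle_frame_iff)
  have v': "norm v' = 1" using frame_tangent_orthogonal[OF rb(1)] by simp
  have nz: "sin ((t2 - t1) / 2) \<noteq> 0" "sin ((t3 - t1) / 2) \<noteq> 0"
    using sin_gt_zero[of "(t2 - t1) / 2"] sin_gt_zero[of "(t3 - t1) / 2"] t by auto
  have "flip P Q - flip P R = ((cot ((t2 - t1) / 2) - cot ((t3 - t1) / 2)) / (2 * r)) *\<^sub>R v'"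
    unfolding Q R P flip_circle_point[OF rb(1) nz(1)] flip_circle_point[OF rb(1) nz(2)]
    by (simp add: algebra_simps diff_divide_distrib)
  moreover have "(cot ((t2 - t1) / 2) - cot ((t3 - t1) / 2)) / (2 * r) > 0"
    using cot_half_less[of "t2 - t1" "t3 - t1"] t r by simp
  ultimately have "sgn (flip P Q - flip P R) = v'"
    using v' by (simp only: sgn_scaleR sgn_div_norm[of v'] sgn_pos) simp
  moreover have "Q \<in> points (oriented_circle c r u' v')"
    unfolding Q points_def oriented_circle_def by force
  ultimately show "C = pencil_circle P Q (sgn (flip P Q - flip P R))"
    using based_circle_as_pencil(1)[OF rb(1) P _ ne(1)] rb(3) C by simp
qed

section \<open>Incenters\<close>

lemma collinear_lineI: "t = q + k *\<^sub>R (r - q) \<Longrightarrow> collinear {q, r, t}"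
  unfolding collinear_def
  by (rule exI[of _ "r - q"])
     (auto intro: exI[of _ "0::real"] exI[of _ "1::real"] exI[of _ "-1::real"] exI[of _ k]
       exI[of _ "-k"] exI[of _ "k - 1"] exI[of _ "1 - k"] simp: algebra_simps)

text \<open>The barycentric formula for the incenter. It has the form of an affine combination, which is
  what a similarity between two models of the triangle preserves.\<close>

definition incenter :: "'a::real_inner \<Rightarrow> 'a \<Rightarrow> 'a \<Rightarrow> 'a" where
  "incenter q r t =
     (norm (r - t) *\<^sub>R q + norm (q - t) *\<^sub>R r + norm (q - r) *\<^sub>R t) /\<^sub>R
     (norm (r - t) + norm (q - t) + norm (q - r))"

lemma incenter_commute: "incenter q r t = incenter r q t" "incenter q r t = incenter t q r"
  by (simp_all add: incenter_def norm_minus_commute add_ac)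

lemma incenter_minus_vertex:
  assumes "q \<noteq> r" "q \<noteq> t"
  shows "incenter q r t - q =
    (- norm (q - r) * norm (q - t) / (norm (r - t) + norm (q - t) + norm (q - r))) *\<^sub>R
      (sgn (q - r) + sgn (q - t))"
proof -
  define a b g where "a = norm (r - t)" and "b = norm (q - t)" and "g = norm (q - r)"
  have pos: "b > 0" "g > 0" "a \<ge> 0" using assms by (auto simp: a_def b_def g_def)
  have sg: "g *\<^sub>R sgn (q - r) = q - r" "b *\<^sub>R sgn (q - t) = q - t"
    using assms by (auto simp: sgn_div_norm g_def b_def)
  have "(a + b + g) *\<^sub>R (incenter q r t - q) = b *\<^sub>R (r - q) + g *\<^sub>R (t - q)"
    using pos unfolding incenter_def a_def[symmetric] b_def[symmetric] g_def[symmetric]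
    by (simp add: scaleR_diff_right) (simp add: algebra_simps)
  also have "\<dots> = - (b *\<^sub>R g *\<^sub>R sgn (q - r) + g *\<^sub>R b *\<^sub>R sgn (q - t))"
    unfolding sg by (simp add: algebra_simps)
  also have "\<dots> = (a + b + g) *\<^sub>R (- g * b / (a + b + g)) *\<^sub>R (sgn (q - r) + sgn (q - t))"
  proof -
    have "(a + b + g) * (- g * b / (a + b + g)) = - (b * g)" using pos by (simp add: mult.commute)
    then show ?thesis by (simp only: scaleR_scaleR) (simp add: scaleR_add_right mult.commute)
  qed
  finally show ?thesis unfolding a_def[symmetric] b_def[symmetric] g_def[symmetric]
    by (rule scaleR_left_imp_eq[rotated]) (use pos in simp)
qed

lemma sgn_sum_nonzero:
  fixes q :: "'a::real_inner"
  assumes "\<not> collinear {q, r, t}"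
  shows "sgn (q - r) + sgn (q - t) \<noteq> 0"
proof
  assume "sgn (q - r) + sgn (q - t) = 0"
  moreover have "norm (q - t) *\<^sub>R sgn (q - t) = q - t"
    by (cases "q = t") (auto simp: sgn_div_norm)
  ultimately have "q - t = - (norm (q - t) *\<^sub>R sgn (q - r))"
    by (metis add_eq_0_iff scaleR_minus_right)
  then have "t = q + (norm (q - t) / norm (q - r)) *\<^sub>R (q - r)"
    unfolding sgn_div_norm scaleR_scaleR divide_inverse
    by (metis add_diff_cancel_left' diff_add_cancel diff_minus_eq_add minus_diff_eq)
  moreover have "x *\<^sub>R (q - r) = (- x) *\<^sub>R (r - q)" for x :: real by (simp add: algebra_simps)
  ultimately have "t = q + (- (norm (q - t) / norm (q - r))) *\<^sub>R (r - q)" by metis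
  with assms show False using collinear_lineI by blast
qed

text \<open>By \<open>incenter_minus_vertex\<close>, the interior bisector at a vertex is the line that joins it to the
  incenter.\<close>

lemma bisector_line_through_incenter:
  assumes "\<not> collinear {q, r, t}"
  shows "range (\<lambda>k. q + k *\<^sub>R sgn (sgn (q - r) + sgn (q - t))) =
    range (\<lambda>k. incenter q r t + k *\<^sub>R (q - incenter q r t))"
proof -
  define z i where "z = sgn (q - r) + sgn (q - t)" and "i = incenter q r t"
  have ne: "q \<noteq> r" "q \<noteq> t" "z \<noteq> 0"
    using assms sgn_sum_nonzero[OF assms] by (auto simp: z_def insert_commute)
  define m where "m = norm (q - r) * norm (q - t) / (norm (r - t) + norm (q - t) + norm (q - r))"
  have "norm (r - t) + norm (q - t) + norm (q - r) > 0"
    using ne by (simp add: add_nonneg_pos)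
  then have "m \<noteq> 0" using ne by (simp add: m_def)
  moreover have "i = q - m *\<^sub>R z"
    using incenter_minus_vertex[OF ne(1,2)] unfolding z_def i_def m_def
    by (simp add: algebra_simps)
  moreover define w where "w = m * norm z"
  ultimately have w: "w \<noteq> 0" "i = q - w *\<^sub>R sgn z" using ne by (auto simp: sgn_div_norm)
  have qi: "q - i = w *\<^sub>R sgn z" using w by simp
  have "q + k *\<^sub>R sgn z = i + (1 + k / w) *\<^sub>R (q - i)" for k
  proof -
    have "i + (1 + k / w) *\<^sub>R (q - i) = i + (w *\<^sub>R sgn z + (k / w * w) *\<^sub>R sgn z)"
      unfolding qi scaleR_add_left[of 1] by (simp only: mult_1 scaleR_scaleR)
    also have "\<dots> = q + k *\<^sub>R sgn z" using w by simp
    finally show ?thesis by simp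
  qed
  moreover have "i + k *\<^sub>R (q - i) = q + ((k - 1) * w) *\<^sub>R sgn z" for k
  proof -
    have "((k - 1) * w) *\<^sub>R sgn z = (k - 1) *\<^sub>R (q - i)" by (simp only: qi scaleR_scaleR)
    then show ?thesis by (simp add: algebra_simps)
  qed
  ultimately have "range (\<lambda>k. q + k *\<^sub>R sgn z) = range (\<lambda>k. i + k *\<^sub>R (q - i))"
    by (intro equalityI image_subsetI) (metis rangeI)+
  then show ?thesis by (simp only: z_def i_def)
qed

text \<open>The incenter does not lie on a side of a nondegenerate triangle, so two of the bisectors meet
  in the incenter only.\<close>

lemma incenter_cevians_independent:
  assumes nc: "\<not> collinear {q, r, t}"
    and eq: "k *\<^sub>R (q - incenter q r t) = l *\<^sub>R (r - incenter q r t)"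
  shows "k = 0"
proof -
  define a b g where "a = norm (r - t)" and "b = norm (q - t)" and "g = norm (q - r)"
  define i where "i = incenter q r t - q"
  have ne: "q \<noteq> r" "q \<noteq> t" using nc by (auto simp: insert_commute)
  then have pos: "b > 0" "g > 0" "a \<ge> 0" by (auto simp: a_def b_def g_def)
  have i: "(a + b + g) *\<^sub>R i = b *\<^sub>R (r - q) + g *\<^sub>R (t - q)"
    using pos unfolding i_def incenter_def a_def[symmetric] b_def[symmetric] g_def[symmetric]
    by (simp add: scaleR_diff_right) (simp add: algebra_simps)
  have li: "(l - k) *\<^sub>R i = l *\<^sub>R (r - q)"
    using eq by (simp add: i_def algebra_simps)
  show "k = 0"
  proof (cases "l = k")
    case True
    then show ?thesis using li ne by simp
  next
    case False
    have "(g * (l - k)) *\<^sub>R (t - q) = (l - k) *\<^sub>R (a + b + g) *\<^sub>R i - ((l - k) * b) *\<^sub>R (r - q)"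
      unfolding i by (simp add: algebra_simps)
    also have "\<dots> = (a + b + g) *\<^sub>R l *\<^sub>R (r - q) - ((l - k) * b) *\<^sub>R (r - q)"
      unfolding li[symmetric] by (simp add: mult.commute)
    also have "\<dots> = ((a + b + g) * l - (l - k) * b) *\<^sub>R (r - q)"
      by (simp add: scaleR_diff_left)
    finally have "(g * (l - k)) *\<^sub>R (t - q) = ((a + b + g) * l - (l - k) * b) *\<^sub>R (r - q)" .
    moreover have "g * (l - k) \<noteq> 0" using False pos by simp
    ultimately have "t - q = (((a + b + g) * l - (l - k) * b) / (g * (l - k))) *\<^sub>R (r - q)"
      by (metis (no_types, lifting) divide_inverse_commute scaleR_scaleR scaleR_one left_inverse)
    then have "t = q + (((a + b + g) * l - (l - k) * b) / (g * (l - k))) *\<^sub>R (r - q)"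
      by (metis add_diff_cancel_left' diff_add_cancel add.commute)
    with nc show ?thesis using collinear_lineI by blast
  qed
qed

section \<open>Noncocircular quadruples\<close>

text \<open>If \<open>Q\<close> and \<open>R\<close> differ from \<open>P\<close>, inversion at \<open>P\<close> reduces the claim to the existence of a line through
  two points. If one of them equals \<open>P\<close>, another point takes its place, at worst the antipode of
  \<open>P\<close>. The lemma is used to infer
  that four points which are not cocircular are distinct.\<close>

lemma three_points_cocircular:
  assumes "P \<in> S3" "Q \<in> S3" "R \<in> S3"
  shows "cocircular {P, Q, R}"
proof -
  have two: "cocircular {P, Q, R}" if S: "P \<in> S3" "Q \<in> S3" "R \<in> S3" and ne: "Q \<noteq> P" "R \<noteq> P" for P Q R
  proof -
    obtain v k where v: "norm v = 1" "v \<bullet> P = 0" and R: "flip P R = flip P Q + k *\<^sub>R v"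
    proof (cases "R = Q")
      case True
      obtain x where "x \<noteq> 0" "x \<bullet> P = 0"
        using orthogonal_to_vector_exists[of P] by (auto simp: orthogonal_def inner_commute)
      then show ?thesis using that[of "sgn x" 0] True by (auto simp: norm_sgn sgn_div_norm)
    next
      case False
      have "flip P R = flip P Q + (- norm (flip P Q - flip P R)) *\<^sub>R sgn (flip P Q - flip P R)"
        by (cases "flip P Q = flip P R") (simp_all add: sgn_div_norm)
      then show ?thesis using that sgn_flip_diff_tangent[OF S ne False] by blast
    qed
    note pc = pencil_circle[OF S(1,2) ne(1) v]
    have "unflip P (flip P Q + 0 *\<^sub>R v) = Q" "unflip P (flip P Q + k *\<^sub>R v) = R"
      by (simp, simp flip: R)
    then have "{P, Q, R} \<subseteq> points (pencil_circle P Q v)" unfolding pc(2)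
      by (metis insert_subset insertI1 insertI2 rangeI empty_subsetI)
    then show ?thesis using pc(1) unfolding cocircular_def by blast
  qed
  have "- P \<bullet> P \<noteq> P \<bullet> P" using assms(1) by (auto simp: norm_eq_1)
  then have "- P \<noteq> P" by metis
  moreover have "- P \<in> S3" using assms(1) by simp
  ultimately have anti: "- P \<in> S3" "- P \<noteq> P" by blast+
  show ?thesis
  proof (cases "Q = P"; cases "R = P")
    assume "Q = P" "R = P"
    then show ?thesis using two[of P "- P" "- P"] anti assms unfolding cocircular_def by auto
  next
    assume "Q = P" "R \<noteq> P"
    then show ?thesis using two[of P R R] assms unfolding cocircular_def by auto
  next
    assume "Q \<noteq> P" "R = P"
    then show ?thesis using two[of P Q Q] assms unfolding cocircular_def by auto
  next
    assume "Q \<noteq> P" "R \<noteq> P"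
    then show ?thesis using two assms by auto
  qed
qed

lemma not_cocircular_distinct:
  assumes S: "P \<in> S3" "Q \<in> S3" "R \<in> S3" "T \<in> S3" and nc: "\<not> cocircular {P, Q, R, T}"
  shows "distinct [P, Q, R, T]"
proof (rule ccontr)
  assume "\<not> distinct [P, Q, R, T]"
  then have "{P, Q, R, T} = {Q, R, T} \<or> {P, Q, R, T} = {P, R, T} \<or> {P, Q, R, T} = {P, Q, R}"
    by auto
  then show False using nc three_points_cocircular S by metis
qed

text \<open>A line through the three inverted points would be the image of a circle through all four
  points.\<close>

lemma not_cocircular_flip:
  assumes S: "P \<in> S3" "Q \<in> S3" "R \<in> S3" "T \<in> S3" and nc: "\<not> cocircular {P, Q, R, T}"
  shows "\<not> collinear {flip P Q, flip P R, flip P T}"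
proof
  have d: "distinct [P, Q, R, T]" by (rule not_cocircular_distinct[OF assms])
  define v where "v = sgn (flip P Q - flip P R)"
  have v: "norm v = 1" "v \<bullet> P = 0"
    using sgn_flip_diff_tangent[OF S(1-3)] d by (auto simp: v_def)
  assume "collinear {flip P Q, flip P R, flip P T}"
  then have "collinear {flip P Q, flip P T, flip P R}" by (simp add: insert_commute)
  moreover have ne: "flip P Q \<noteq> flip P R" using d by (metis distinct_length_2_or_more unflip_flip)
  ultimately obtain u where "flip P T = u *\<^sub>R flip P Q + (1 - u) *\<^sub>R flip P R"
    using collinear_3_expand by blast
  moreover have "flip P R = flip P Q + (- norm (flip P Q - flip P R)) *\<^sub>R v"
    using ne by (simp add: v_def sgn_div_norm)
  ultimately obtain l where R: "flip P R = flip P Q + l *\<^sub>R v"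
    and T: "flip P T = u *\<^sub>R flip P Q + (1 - u) *\<^sub>R flip P R" by blast
  define k where "k = (1 - u) * l"
  have T': "flip P T = flip P Q + k *\<^sub>R v" unfolding T R k_def by (simp add: algebra_simps)
  have "Q \<noteq> P" using d by auto
  note pc = pencil_circle[OF S(1,2) this v]
  have "unflip P (flip P Q + 0 *\<^sub>R v) = Q" "unflip P (flip P Q + k *\<^sub>R v) = T"
    "unflip P (flip P Q + l *\<^sub>R v) = R"
    by (simp, simp flip: T', simp flip: R)
  then have "{P, Q, R, T} \<subseteq> points (pencil_circle P Q v)" unfolding pc(2)
    by (metis insert_subset insertI1 insertI2 rangeI empty_subsetI)
  then show False using pc(1) nc unfolding cocircular_def by blast
qed

section \<open>The dual point as an incenter\<close>

lemma unit_vector_maximising_inner: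
  fixes v z :: "'a::real_inner"
  assumes "norm v = 1" "norm z \<le> v \<bullet> z" "z \<noteq> 0"
  shows "v = sgn z"
proof -
  have "v \<bullet> z = norm v * norm z"
    using assms norm_cauchy_schwarz[of v z] by simp
  then have "norm v *\<^sub>R z = norm z *\<^sub>R v" by (simp add: norm_cauchy_schwarz_eq)
  then have "z = norm z *\<^sub>R v" using assms(1) by simp
  then have "z /\<^sub>R norm z = (norm z *\<^sub>R v) /\<^sub>R norm z" by (rule arg_cong)
  then show ?thesis using assms(3) by (simp add: sgn_div_norm)
qed

lemma abs_inner_unit_le:
  fixes v w :: "'a::real_inner"
  assumes "norm v = 1" "norm w = 1"
  shows "\<bar>v \<bullet> w\<bar> \<le> 1"
  using Cauchy_Schwarz_ineq2[of v w] assms by simp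

text \<open>Among the unit vectors \<open>v\<close> with \<open>v \<bullet> v\<^sub>1 = v \<bullet> v\<^sub>2\<close>, the smallest angle means the largest value of
  \<open>v \<bullet> v\<^sub>1 = v \<bullet> (v\<^sub>1 + v\<^sub>2) / 2\<close>, which by Cauchy-Schwarz is attained only at the normalised sum.\<close>

lemma angle_bisector_eq_pencil:
  assumes S: "P \<in> S3" "Q \<in> S3" "R \<in> S3" "T \<in> S3"
    and ne: "Q \<noteq> P" "R \<noteq> P" "T \<noteq> P" "R \<noteq> Q" "T \<noteq> Q"
  defines "v\<^sub>1 \<equiv> sgn (flip P Q - flip P R)" and "v\<^sub>2 \<equiv> sgn (flip P Q - flip P T)"
  assumes nz: "v\<^sub>1 + v\<^sub>2 \<noteq> 0"
  shows "angle_bisector P Q R T = pencil_circle P Q (sgn (v\<^sub>1 + v\<^sub>2))"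
proof -
  note v1 = sgn_flip_diff_tangent[OF S(1,2,3) ne(1,2,4), folded v\<^sub>1_def]
  note v2 = sgn_flip_diff_tangent[OF S(1,2,4) ne(1,3,5), folded v\<^sub>2_def]
  note ct1 = circle_through_eq_pencil[OF S(1,2,3) ne(1,2,4), folded v\<^sub>1_def]
  note ct2 = circle_through_eq_pencil[OF S(1,2,4) ne(1,3,5), folded v\<^sub>2_def]
  note pt = pencil_circle(3)[OF S(1,2) ne(1)]
  have ang: "circle_angle P (pencil_circle P Q v) (circle_through P Q R) = arccos (v \<bullet> v\<^sub>1)"
    "circle_angle P (pencil_circle P Q v) (circle_through P Q T) = arccos (v \<bullet> v\<^sub>2)"
    if "norm v = 1" "v \<bullet> P = 0" for v
    using that v1 v2 by (simp_all add: circle_angle_def ct1 ct2 pt)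
  have mem: "C \<in> equal_angle_circles P Q R T \<longleftrightarrow>
      (\<exists>v. norm v = 1 \<and> v \<bullet> P = 0 \<and> C = pencil_circle P Q v \<and> v \<bullet> v\<^sub>1 = v \<bullet> v\<^sub>2)" for C
  proof -
    have "C \<in> equal_angle_circles P Q R T \<longleftrightarrow>
      (\<exists>v. norm v = 1 \<and> v \<bullet> P = 0 \<and> C = pencil_circle P Q v \<and>
        arccos (v \<bullet> v\<^sub>1) = arccos (v \<bullet> v\<^sub>2))"
      using circles_through_two_points[OF S(1,2) ne(1), of C] ang
      unfolding equal_angle_circles_def by auto
    also have "\<dots> \<longleftrightarrow> (\<exists>v. norm v = 1 \<and> v \<bullet> P = 0 \<and> C = pencil_circle P Q v \<and> v \<bullet> v\<^sub>1 = v \<bullet> v\<^sub>2)"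
      using v1 v2 abs_inner_unit_le by (metis arccos_eq_iff)
    finally show ?thesis .
  qed
  define z w where "z = v\<^sub>1 + v\<^sub>2" and "w = sgn z"
  have z: "z \<noteq> 0" using nz by (simp add: z_def)
  have w: "norm w = 1" "w \<bullet> P = 0"
    using z v1 v2 by (simp_all add: w_def norm_sgn, simp add: sgn_div_norm z_def inner_add_left)
  have "(v\<^sub>1 + v\<^sub>2) \<bullet> v\<^sub>1 = (v\<^sub>1 + v\<^sub>2) \<bullet> v\<^sub>2"
    using v1 v2 unfolding norm_eq_1 inner_add_left inner_commute[of v\<^sub>2 v\<^sub>1] by simp
  then have w12: "w \<bullet> v\<^sub>1 = w \<bullet> v\<^sub>2"
    by (simp add: w_def z_def sgn_div_norm)
  have wz: "w \<bullet> z = norm z"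
    using z by (simp add: w_def sgn_div_norm dot_square_norm power2_eq_square)
  have half: "2 * (v \<bullet> v\<^sub>1) = v \<bullet> z" if "v \<bullet> v\<^sub>1 = v \<bullet> v\<^sub>2" for v
    using that by (simp add: z_def inner_add_right)
  have le: "v \<bullet> v\<^sub>1 \<le> w \<bullet> v\<^sub>1" if "norm v = 1" "v \<bullet> v\<^sub>1 = v \<bullet> v\<^sub>2" for v
    using half[OF that(2)] half[OF w12] wz norm_cauchy_schwarz[of v z] that(1) by simp
  show ?thesis unfolding angle_bisector_def z_def[symmetric] w_def[symmetric]
  proof (rule the_equality)
    show "is_arg_min (\<lambda>C. circle_angle P C (circle_through P Q R))
        (\<lambda>C. C \<in> equal_angle_circles P Q R T) (pencil_circle P Q w)"
      unfolding is_arg_min_def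
    proof (intro conjI notI)
      show "pencil_circle P Q w \<in> equal_angle_circles P Q R T"
        using mem w w12 by blast
      assume "\<exists>C. C \<in> equal_angle_circles P Q R T \<and>
        circle_angle P C (circle_through P Q R) <
        circle_angle P (pencil_circle P Q w) (circle_through P Q R)"
      then obtain v where v: "norm v = 1" "v \<bullet> P = 0" "v \<bullet> v\<^sub>1 = v \<bullet> v\<^sub>2"
        "arccos (v \<bullet> v\<^sub>1) < arccos (w \<bullet> v\<^sub>1)"
        using mem ang w by auto
      then show False using le[OF v(1,3)] v1 w abs_inner_unit_le
        by (metis arccos_less_mono not_less)
    qed
  next
    fix C assume C: "is_arg_min (\<lambda>C. circle_angle P C (circle_through P Q R))
        (\<lambda>C. C \<in> equal_angle_circles P Q R T) C"
    then obtain v where v: "norm v = 1" "v \<bullet> P = 0" "v \<bullet> v\<^sub>1 = v \<bullet> v\<^sub>2" "C = pencil_circle P Q v"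
      using mem unfolding is_arg_min_def by auto
    have "pencil_circle P Q w \<in> equal_angle_circles P Q R T" using mem w w12 by blast
    with C have "\<not> arccos (w \<bullet> v\<^sub>1) < arccos (v \<bullet> v\<^sub>1)"
      unfolding is_arg_min_def using ang[OF v(1,2)] ang[OF w] v(4) by auto
    then have "\<not> v \<bullet> v\<^sub>1 < w \<bullet> v\<^sub>1"
      using abs_inner_unit_le v(1) v1(1) w(1) by (metis arccos_less_mono)
    then have "norm z \<le> v \<bullet> z" using half[OF v(3)] half[OF w12] wz by simp
    then have "v = w" unfolding w_def by (rule unit_vector_maximising_inner[OF v(1) _ z])
    then show "C = pencil_circle P Q w" using v(4) by simp
  qed
qed

lemma points_angle_bisector:
  assumes S: "P \<in> S3" "Q \<in> S3" "R \<in> S3" "T \<in> S3" and nc: "\<not> cocircular {P, Q, R, T}"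
  defines "i \<equiv> incenter (flip P Q) (flip P R) (flip P T)"
  shows "points (angle_bisector P Q R T) =
    insert P (unflip P ` range (\<lambda>k. i + k *\<^sub>R (flip P Q - i)))"
proof -
  note d = not_cocircular_distinct[OF S nc] and n = not_cocircular_flip[OF S nc]
  define z where "z = sgn (flip P Q - flip P R) + sgn (flip P Q - flip P T)"
  have z: "z \<noteq> 0" unfolding z_def by (rule sgn_sum_nonzero[OF n])
  have ne: "Q \<noteq> P" "R \<noteq> P" "T \<noteq> P" "R \<noteq> Q" "T \<noteq> Q" using d by auto
  have eq: "angle_bisector P Q R T = pencil_circle P Q (sgn z)"
    using angle_bisector_eq_pencil[OF S ne] z by (simp add: z_def)
  have "norm (sgn z) = 1" using z by (simp add: norm_sgn)
  moreover have "sgn z \<bullet> P = 0"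
    using sgn_flip_diff_tangent[OF S(1,2,3)] sgn_flip_diff_tangent[OF S(1,2,4)] ne
    by (simp add: z_def sgn_div_norm[of "_ + _"] inner_add_left)
  ultimately have "points (angle_bisector P Q R T) =
      insert P (range (\<lambda>s. unflip P (flip P Q + s *\<^sub>R sgn z)))"
    unfolding eq by (rule pencil_circle(2)[OF S(1,2) ne(1)])
  also have "\<dots> = insert P (unflip P ` range (\<lambda>s. flip P Q + s *\<^sub>R sgn z))"
    by (simp add: image_image)
  finally show ?thesis unfolding z_def bisector_line_through_incenter[OF n] i_def .
qed

text \<open>Inversion at \<open>P\<close> turns the three bisecting circles into the three interior angle bisectors of the
  triangle formed by the inverted points.\<close>

lemma flip_dual_point:
  assumes S: "P \<in> S3" "Q \<in> S3" "R \<in> S3" "T \<in> S3" and nc: "\<not> cocircular {P, Q, R, T}"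
  shows "flip P (dual_point P Q R T) = incenter (flip P Q) (flip P R) (flip P T)"
proof -
  define i where "i = incenter (flip P Q) (flip P R) (flip P T)"
  note n = not_cocircular_flip[OF S nc]
  define L where "L = (\<lambda>X. range (\<lambda>k. i + k *\<^sub>R (flip P X - i)))"
  have i': "i = incenter (flip P R) (flip P Q) (flip P T)" "i = incenter (flip P T) (flip P Q) (flip P R)"
    unfolding i_def by (rule incenter_commute)+
  have nc': "\<not> cocircular {P, R, Q, T}" "\<not> cocircular {P, T, Q, R}"
    using nc by (simp_all add: insert_commute)
  have pts: "points (angle_bisector P Q R T) = insert P (unflip P ` L Q)"
    "points (angle_bisector P R Q T) = insert P (unflip P ` L R)"
    "points (angle_bisector P T Q R) = insert P (unflip P ` L T)"
    using points_angle_bisector[OF S nc] points_angle_bisector[OF S(1,3,2,4) nc'(1)]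
      points_angle_bisector[OF S(1,4,2,3) nc'(2)]
    unfolding L_def i_def[symmetric] i'[symmetric] by auto
  have mem: "i \<in> L X" for X unfolding L_def by (rule range_eqI[of _ _ 0]) simp
  have "L Q \<inter> L R \<subseteq> {i}"
  proof
    fix y assume "y \<in> L Q \<inter> L R"
    then obtain k l where k: "y = i + k *\<^sub>R (flip P Q - i)" and l: "y = i + l *\<^sub>R (flip P R - i)"
      unfolding L_def by blast
    then have "k *\<^sub>R (flip P Q - i) = l *\<^sub>R (flip P R - i)" by simp
    then have "k = 0" unfolding i_def by (rule incenter_cevians_independent[OF n])
    with k show "y \<in> {i}" by simp
  qed
  then have "L Q \<inter> L R \<inter> L T = {i}" using mem by blast
  moreover have "points (angle_bisector P Q R T) \<inter> points (angle_bisector P R Q T) \<inter>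
     points (angle_bisector P T Q R) = insert P (unflip P ` (L Q \<inter> L R \<inter> L T))"
    unfolding pts image_Int[OF inj_unflip] by blast
  ultimately have "dual_point P Q R T = (THE X. {P, unflip P i} = {P, X})"
    unfolding dual_point_def by simp
  also have "\<dots> = unflip P i" by (rule the_equality) (auto simp: doubleton_eq_iff)
  finally show ?thesis by (simp add: i_def)
qed

section \<open>Affine combinations and similarities\<close>

text \<open>Put \<open>u\<^sub>j = z - y\<^sub>j\<close>. As the weights sum to one, the left-hand side is \<open>|\<Sum>\<^sub>j l\<^sub>j u\<^sub>j|\<^sup>2\<close>, and polarisation
  expresses each \<open>u\<^sub>i \<bullet> u\<^sub>j\<close> by distances.\<close>

lemma norm_affine_combination:
  fixes y :: "'i \<Rightarrow> 'a::real_inner"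
  assumes "(\<Sum>j\<in>J. l j) = 1"
  shows "(norm (z - (\<Sum>j\<in>J. l j *\<^sub>R y j)))\<^sup>2 =
    (\<Sum>j\<in>J. l j * (norm (z - y j))\<^sup>2) - (\<Sum>i\<in>J. \<Sum>j\<in>J. l i * l j * (norm (y i - y j))\<^sup>2) / 2"
proof -
  define u where "u = (\<lambda>j. z - y j)"
  have ip: "u i \<bullet> u j = ((norm (u i))\<^sup>2 + (norm (u j))\<^sup>2 - (norm (y i - y j))\<^sup>2) / 2" for i j
    unfolding u_def power2_norm_eq_inner
    by (simp add: inner_diff_left inner_diff_right inner_commute field_simps)
  have "z - (\<Sum>j\<in>J. l j *\<^sub>R y j) = (\<Sum>j\<in>J. l j *\<^sub>R u j)"
    using assms by (simp add: u_def scaleR_diff_right sum_subtractf flip: scaleR_left.sum)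
  then have "(norm (z - (\<Sum>j\<in>J. l j *\<^sub>R y j)))\<^sup>2 = (\<Sum>i\<in>J. \<Sum>j\<in>J. l i * l j * (u i \<bullet> u j))"
    by (simp add: power2_norm_eq_inner inner_sum_left inner_sum_right sum_distrib_left mult_ac
        inner_commute)
  also have "\<dots> = (\<Sum>i\<in>J. \<Sum>j\<in>J. l i * (norm (u i))\<^sup>2 * l j / 2 + l i * (l j * (norm (u j))\<^sup>2) / 2
      - l i * l j * (norm (y i - y j))\<^sup>2 / 2)"
    unfolding ip by (intro sum.cong refl) (simp add: field_simps)
  also have "\<dots> = (\<Sum>i\<in>J. l i * (norm (u i))\<^sup>2) * (\<Sum>j\<in>J. l j) / 2 + (\<Sum>i\<in>J. l i) * (\<Sum>j\<in>J. l j * (norm (u j))\<^sup>2) / 2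
      - (\<Sum>i\<in>J. \<Sum>j\<in>J. l i * l j * (norm (y i - y j))\<^sup>2) / 2"
    by (simp only: sum.distrib sum_subtractf sum_product sum_divide_distrib)
  finally show ?thesis using assms by (simp add: u_def)
qed

text \<open>A map that multiplies all distances by the same factor preserves affine combinations; it is
  enough to know this on the points of the combination and on its value. This moves the incenter
  from one model of the 2-sphere to another without comparing the models in coordinates.\<close>

lemma affine_combination_similarity:
  fixes f :: "'i \<Rightarrow> 'a::real_inner" and g :: "'i \<Rightarrow> 'b::real_inner"
  assumes sim: "\<And>i j. i \<in> insert x J \<Longrightarrow> j \<in> insert x J \<Longrightarrow> norm (g i - g j) = k * norm (f i - f j)"
    and one: "(\<Sum>j\<in>J. l j) = 1" and f: "f x = (\<Sum>j\<in>J. l j *\<^sub>R f j)"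
  shows "g x = (\<Sum>j\<in>J. l j *\<^sub>R g j)"
proof -
  have "(norm (g x - (\<Sum>j\<in>J. l j *\<^sub>R g j)))\<^sup>2 =
      (\<Sum>j\<in>J. l j * (k * norm (f x - f j))\<^sup>2)
      - (\<Sum>i\<in>J. \<Sum>j\<in>J. l i * l j * (k * norm (f i - f j))\<^sup>2) / 2"
    unfolding norm_affine_combination[OF one] by (simp add: sim)
  also have "\<dots> = k\<^sup>2 * (norm (f x - (\<Sum>j\<in>J. l j *\<^sub>R f j)))\<^sup>2"
    unfolding norm_affine_combination[OF one]
    by (simp add: power_mult_distrib right_diff_distrib sum_distrib_left mult_ac)
  finally show ?thesis using f by simp
qed


section \<open>Homogeneous coordinates and the cross ratio of dual vectors\<close>

text \<open>The determinant of two vectors, read as homogeneous coordinates of points of the Riemann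
  sphere.\<close>

definition wedge :: "complex \<times> complex \<Rightarrow> complex \<times> complex \<Rightarrow> complex" where
  "wedge x y = fst x * snd y - snd x * fst y"

text \<open>Multiplication by a complex scalar; the vector space structure of the library on pairs of
  complex numbers is the real one.\<close>

definition cscale :: "complex \<Rightarrow> complex \<times> complex \<Rightarrow> complex \<times> complex" where
  "cscale c x = (c * fst x, c * snd x)"

fun homog :: "ecomplex \<Rightarrow> complex \<times> complex" where
  "homog (Fin z) = (z, 1)"
| "homog Infty = (1, 0)"

text \<open>In homogeneous coordinates the point at infinity needs no separate formula. The hypotheses
  exclude that \<open>x\<^sub>1, x\<^sub>4\<close> or \<open>x\<^sub>2, x\<^sub>3\<close> are both infinite, where the quotient differs from the dummy value
  in the definition; for the other pairs both are zero.\<close>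

lemma cross_ratio_homog:
  assumes "wedge (homog x\<^sub>1) (homog x\<^sub>4) \<noteq> 0" "wedge (homog x\<^sub>2) (homog x\<^sub>3) \<noteq> 0"
  shows "cross_ratio x\<^sub>1 x\<^sub>2 x\<^sub>3 x\<^sub>4 =
    wedge (homog x\<^sub>2) (homog x\<^sub>1) * wedge (homog x\<^sub>3) (homog x\<^sub>4) /
    (wedge (homog x\<^sub>2) (homog x\<^sub>4) * wedge (homog x\<^sub>3) (homog x\<^sub>1))"
proof -
  have "(a - b) / (c - d) = (b - a) / (d - c)" for a b c d :: complex
    by (metis minus_diff_eq minus_divide_divide)
  note rev = this
  show ?thesis
    using assms by (cases x\<^sub>1; cases x\<^sub>2; cases x\<^sub>3; cases x\<^sub>4) (auto simp: wedge_def intro: rev)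
qed

lemma wedge_commute: "wedge x y = - wedge y x"
  by (simp add: wedge_def)

lemma wedge_cscale: "wedge (cscale a x) (cscale b y) = a * b * wedge x y"
  by (simp add: wedge_def cscale_def algebra_simps)

lemma norm_cscale: "norm (cscale c x) = cmod c * norm x"
  by (simp add: cscale_def norm_Pair norm_mult power_mult_distrib flip: distrib_left)
     (simp add: real_sqrt_mult norm_prod_def)

text \<open>This is the Pluecker relation between three vectors of the plane. It shows that the vectors
  \<open>x / wedge x p\<close> run along a complex line with direction \<open>p\<close>: they are an affine coordinate of the
  Riemann sphere which is infinite at \<open>p\<close>, and this without the choice of a second base vector.\<close>

lemma wedge_quotient_diff:
  assumes "wedge x p \<noteq> 0" "wedge y p \<noteq> 0"
  shows "cscale (1 / wedge x p) x - cscale (1 / wedge y p) y =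
    cscale (- wedge x y / (wedge x p * wedge y p)) p"
  using assms
  by (auto simp: cscale_def prod_eq_iff field_simps) (auto simp: wedge_def algebra_simps)

text \<open>Homogeneous coordinates of the point dual to \<open>p\<close>. Each \<open>q / wedge q p\<close> is an affine coordinate with
  \<open>p\<close> at infinity, and the weight \<open>|wedge q p| |wedge r t|\<close> is, up to a common factor, the length of
  the side opposite to \<open>q\<close> in this coordinate. The sum of the weights is not divided out.\<close>

definition dual_vector ::
    "complex \<times> complex \<Rightarrow> complex \<times> complex \<Rightarrow> complex \<times> complex \<Rightarrow> complex \<times> complex \<Rightarrow> complex \<times> complex" where
  "dual_vector p q r t =
     cscale (cmod (wedge q p * wedge r t) / wedge q p) q +
     cscale (cmod (wedge r p * wedge q t) / wedge r p) r +
     cscale (cmod (wedge t p * wedge q r) / wedge t p) t"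

lemma cmod_wedge_commute: "cmod (wedge x y) = cmod (wedge y x)"
  by (metis wedge_commute norm_minus_cancel)

lemma dual_vector_commute:
  "dual_vector p q r t = dual_vector p r q t" "dual_vector p q r t = dual_vector p q t r"
  by (simp_all add: dual_vector_def norm_mult cmod_wedge_commute[of r q] cmod_wedge_commute[of t _]
      add_ac)

lemma wedge_add_left: "wedge (x + y) z = wedge x z + wedge y z"
  by (simp add: wedge_def algebra_simps)

lemma wedge_add_right: "wedge x (y + z) = wedge x y + wedge x z"
  by (simp add: wedge_def algebra_simps)

lemma plucker: "wedge p q * wedge r t + wedge p r * wedge t q + wedge p t * wedge q r = 0"
  by (simp add: wedge_def algebra_simps)

text \<open>With the Pluecker products \<open>x, y, z\<close> and their moduli \<open>a, b, c\<close>, bilinearity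
  gives \<open>(a\<^sup>2 + 2 a b + 2 a c) / wedge p q\<close> plus a remainder proportional to \<open>- b\<^sup>2 / y - c\<^sup>2 / z\<close>.
  Since \<open>b\<^sup>2 / y = cnj y\<close> and \<open>c\<^sup>2 / z = cnj z\<close>, the relation \<open>x + y + z = 0\<close> turns the remainder into
  another \<open>a\<^sup>2 / wedge p q\<close>. This is where the complex conjugation enters.\<close>

lemma wedge_dual_vector:
  assumes nz: "wedge p q \<noteq> 0" "wedge p r \<noteq> 0" "wedge p t \<noteq> 0" "wedge q r \<noteq> 0" "wedge q t \<noteq> 0"
  shows "wedge (dual_vector p q r t) (dual_vector q p r t) =
    2 * (cmod (wedge p q * wedge r t) + cmod (wedge p r * wedge q t) + cmod (wedge p t * wedge q r)) *
    cmod (wedge p q * wedge r t) / wedge p q"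
proof -
  define x y z where "x = wedge p q * wedge r t" and "y = wedge p r * wedge t q"
    and "z = wedge p t * wedge q r"
  define a b c where "a = complex_of_real (cmod x)" and "b = complex_of_real (cmod y)"
    and "c = complex_of_real (cmod z)"
  have sq: "a\<^sup>2 = x * cnj x" "b\<^sup>2 = y * cnj y" "c\<^sup>2 = z * cnj z"
    by (simp_all add: a_def b_def c_def complex_norm_square flip: of_real_power)
  have sum0: "x + y + z = 0" unfolding x_def y_def z_def by (rule plucker)
  have mods: "complex_of_real (cmod (wedge p q * wedge r t)) = a"
      "complex_of_real (cmod (wedge p r * wedge q t)) = b"
      "complex_of_real (cmod (wedge p t * wedge q r)) = c"
    by (simp_all add: a_def b_def c_def x_def y_def z_def norm_mult cmod_wedge_commute[of q t])
  have self: "wedge v v = 0" for v by (simp add: wedge_def)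
  define pq pr pt qr qt rt where "pq = wedge p q" and "pr = wedge p r" and "pt = wedge p t"
    and "qr = wedge q r" and "qt = wedge q t" and "rt = wedge r t"
  note names = pq_def[symmetric] pr_def[symmetric] pt_def[symmetric] qr_def[symmetric]
    qt_def[symmetric] rt_def[symmetric]
  have comm: "wedge q p = - pq" "wedge r p = - pr" "wedge t p = - pt" "wedge r q = - qr"
    "wedge t q = - qt" "wedge t r = - rt"
    unfolding names[symmetric] by (metis wedge_commute)+
  have dp: "dual_vector p q r t = cscale (- a / pq) q + cscale (- b / pr) r + cscale (- c / pt) t"
    unfolding dual_vector_def
    by (simp add: comm names norm_mult mods[unfolded norm_mult names, simplified])
  have dq: "dual_vector q p r t = cscale (a / pq) p + cscale (- c / qr) r + cscale (- b / qt) t"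
    unfolding dual_vector_def
    by (simp add: comm names norm_mult mods[unfolded norm_mult names, simplified] mult_ac)
  have "wedge (dual_vector p q r t) (dual_vector q p r t) =
      (a\<^sup>2 + 2 * a * b + 2 * a * c) / pq + rt * (b\<^sup>2 / (pr * qt) - c\<^sup>2 / (pt * qr))"
    unfolding dp dq wedge_add_left wedge_add_right wedge_cscale comm self names
    using nz[unfolded names] by (simp add: field_simps power2_eq_square)
  also have "b\<^sup>2 / (pr * qt) = - cnj y"
    using nz[unfolded names] unfolding sq by (simp add: y_def comm names)
  also have "c\<^sup>2 / (pt * qr) = cnj z"
    using nz[unfolded names] unfolding sq by (simp add: z_def names)
  also have "- cnj y - cnj z = cnj x"
    using sum0 by (metis (no_types, lifting) add.assoc add_diff_cancel_right' complex_cnj_add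
        complex_cnj_zero diff_0 minus_diff_eq add_uminus_conv_diff minus_add_distrib)
  also have "rt * cnj x = a\<^sup>2 / pq"
    using nz(1)[unfolded names] unfolding sq by (simp add: x_def names)
  finally show ?thesis
    using nz(1) unfolding of_real_mult[of 2] of_real_mult[of "2 * _"] of_real_add of_real_numeral mods
    unfolding names by (simp add: field_simps power2_eq_square)
qed

text \<open>By \<open>wedge_dual_vector\<close>, the wedge of the duals of \<open>v\<close> and \<open>w\<close> is \<open>|x| / wedge v w\<close> times a factor
  common to all pairs, where \<open>x\<close> is the Pluecker product of the pair \<open>v, w\<close> with the complementary
  pair. In the cross ratio complementary pairs occur together, and \<open>|x|\<^sup>2 / x = cnj x\<close>.\<close>

lemma cross_ratio_dual_vectors:
  assumes nz: "wedge v\<^sub>1 v\<^sub>2 \<noteq> 0" "wedge v\<^sub>1 v\<^sub>3 \<noteq> 0" "wedge v\<^sub>1 v\<^sub>4 \<noteq> 0"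
    "wedge v\<^sub>2 v\<^sub>3 \<noteq> 0" "wedge v\<^sub>2 v\<^sub>4 \<noteq> 0" "wedge v\<^sub>3 v\<^sub>4 \<noteq> 0"
  defines "w\<^sub>1 \<equiv> dual_vector v\<^sub>1 v\<^sub>2 v\<^sub>3 v\<^sub>4" and "w\<^sub>2 \<equiv> dual_vector v\<^sub>2 v\<^sub>1 v\<^sub>3 v\<^sub>4"
    and "w\<^sub>3 \<equiv> dual_vector v\<^sub>3 v\<^sub>1 v\<^sub>2 v\<^sub>4" and "w\<^sub>4 \<equiv> dual_vector v\<^sub>4 v\<^sub>1 v\<^sub>2 v\<^sub>3"
  shows "wedge w\<^sub>1 w\<^sub>4 \<noteq> 0" "wedge w\<^sub>2 w\<^sub>3 \<noteq> 0"
    "wedge w\<^sub>2 w\<^sub>1 * wedge w\<^sub>3 w\<^sub>4 / (wedge w\<^sub>2 w\<^sub>4 * wedge w\<^sub>3 w\<^sub>1) =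
      cnj (wedge v\<^sub>2 v\<^sub>1 * wedge v\<^sub>3 v\<^sub>4 / (wedge v\<^sub>2 v\<^sub>4 * wedge v\<^sub>3 v\<^sub>1))"
proof -
  define A where "A = cmod (wedge v\<^sub>2 v\<^sub>1 * wedge v\<^sub>3 v\<^sub>4)"
  define B where "B = cmod (wedge v\<^sub>2 v\<^sub>4 * wedge v\<^sub>3 v\<^sub>1)"
  define C where "C = cmod (wedge v\<^sub>1 v\<^sub>4 * wedge v\<^sub>2 v\<^sub>3)"
  define S where "S = A + B + C"
  have nz': "wedge x y \<noteq> 0" if "wedge y x \<noteq> 0" for x y
    using that by (metis wedge_commute neg_equal_0_iff_equal)
  note nz_all = nz nz[THEN nz']
  have pos: "A > 0" "B > 0" "C > 0" "S > 0"
    using nz_all by (auto simp: A_def B_def C_def S_def add_pos_pos)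
  note mods = cmod_wedge_commute[of v\<^sub>1 v\<^sub>2] cmod_wedge_commute[of v\<^sub>1 v\<^sub>3]
    cmod_wedge_commute[of v\<^sub>4 v\<^sub>3] cmod_wedge_commute[of v\<^sub>4 v\<^sub>2]
    cmod_wedge_commute[of v\<^sub>4 v\<^sub>1] cmod_wedge_commute[of v\<^sub>3 v\<^sub>2]
  have w: "wedge w\<^sub>2 w\<^sub>1 = 2 * S * A / wedge v\<^sub>2 v\<^sub>1" "wedge w\<^sub>3 w\<^sub>4 = 2 * S * A / wedge v\<^sub>3 v\<^sub>4"
    "wedge w\<^sub>2 w\<^sub>4 = 2 * S * B / wedge v\<^sub>2 v\<^sub>4" "wedge w\<^sub>3 w\<^sub>1 = 2 * S * B / wedge v\<^sub>3 v\<^sub>1"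
    "wedge w\<^sub>1 w\<^sub>4 = 2 * S * C / wedge v\<^sub>1 v\<^sub>4" "wedge w\<^sub>2 w\<^sub>3 = 2 * S * C / wedge v\<^sub>2 v\<^sub>3"
  proof -
    have "wedge (dual_vector a b c d) (dual_vector b a c d) =
        2 * S * cmod (wedge a b * wedge c d) / wedge a b"
      if "wedge a b \<noteq> 0" "wedge a c \<noteq> 0" "wedge a d \<noteq> 0" "wedge b c \<noteq> 0" "wedge b d \<noteq> 0"
        "S = cmod (wedge a b * wedge c d) + cmod (wedge a c * wedge b d) + cmod (wedge a d * wedge b c)"
      for a b c d
      using wedge_dual_vector[OF that(1-5)] that(6) by simp
    note r = this[unfolded norm_mult]
    have S: "S = cmod (wedge v\<^sub>2 v\<^sub>1) * cmod (wedge v\<^sub>3 v\<^sub>4) + cmod (wedge v\<^sub>2 v\<^sub>4) * cmod (wedge v\<^sub>3 v\<^sub>1)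
        + cmod (wedge v\<^sub>1 v\<^sub>4) * cmod (wedge v\<^sub>2 v\<^sub>3)"
      by (simp add: S_def A_def B_def C_def norm_mult)
    show "wedge w\<^sub>2 w\<^sub>1 = 2 * S * A / wedge v\<^sub>2 v\<^sub>1"
      using r[of v\<^sub>2 v\<^sub>1 v\<^sub>3 v\<^sub>4] nz_all by (simp add: S A_def w\<^sub>1_def w\<^sub>2_def norm_mult mods mult_ac)
    show "wedge w\<^sub>3 w\<^sub>4 = 2 * S * A / wedge v\<^sub>3 v\<^sub>4"
      using r[of v\<^sub>3 v\<^sub>4 v\<^sub>1 v\<^sub>2] nz_all unfolding w\<^sub>3_def w\<^sub>4_def
      by (simp add: S A_def norm_mult mods mult_ac add_ac dual_vector_commute)
    show "wedge w\<^sub>2 w\<^sub>4 = 2 * S * B / wedge v\<^sub>2 v\<^sub>4"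
      using r[of v\<^sub>2 v\<^sub>4 v\<^sub>1 v\<^sub>3] nz_all unfolding w\<^sub>2_def w\<^sub>4_def
      by (simp add: S B_def norm_mult mods mult_ac add_ac dual_vector_commute)
    show "wedge w\<^sub>3 w\<^sub>1 = 2 * S * B / wedge v\<^sub>3 v\<^sub>1"
      using r[of v\<^sub>3 v\<^sub>1 v\<^sub>2 v\<^sub>4] nz_all unfolding w\<^sub>3_def w\<^sub>1_def
      by (simp add: S B_def norm_mult mods mult_ac add_ac dual_vector_commute)
    show "wedge w\<^sub>1 w\<^sub>4 = 2 * S * C / wedge v\<^sub>1 v\<^sub>4"
      using r[of v\<^sub>1 v\<^sub>4 v\<^sub>2 v\<^sub>3] nz_all unfolding w\<^sub>1_def w\<^sub>4_def
      by (simp add: S C_def norm_mult mods mult_ac add_ac dual_vector_commute)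
    show "wedge w\<^sub>2 w\<^sub>3 = 2 * S * C / wedge v\<^sub>2 v\<^sub>3"
      using r[of v\<^sub>2 v\<^sub>3 v\<^sub>1 v\<^sub>4] nz_all unfolding w\<^sub>2_def w\<^sub>3_def
      by (simp add: S C_def norm_mult mods mult_ac add_ac dual_vector_commute)
  qed
  show "wedge w\<^sub>1 w\<^sub>4 \<noteq> 0" "wedge w\<^sub>2 w\<^sub>3 \<noteq> 0"
    unfolding w using pos nz_all by auto
  have conj_quotient: "complex_of_real (cmod z) / z = cnj z / cmod z" if "z \<noteq> 0" for z
    using that complex_norm_square[of z] by (simp add: field_simps power2_eq_square)
  define x y where "x = wedge v\<^sub>2 v\<^sub>1 * wedge v\<^sub>3 v\<^sub>4" and "y = wedge v\<^sub>2 v\<^sub>4 * wedge v\<^sub>3 v\<^sub>1"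
  have xy: "x \<noteq> 0" "y \<noteq> 0" using nz_all by (auto simp: x_def y_def)
  have "wedge w\<^sub>2 w\<^sub>1 * wedge w\<^sub>3 w\<^sub>4 / (wedge w\<^sub>2 w\<^sub>4 * wedge w\<^sub>3 w\<^sub>1) =
      (complex_of_real A * (complex_of_real A / x)) / (complex_of_real B * (complex_of_real B / y))"
    unfolding w x_def y_def using pos nz_all by (simp add: field_simps)
  also have "\<dots> = cnj x / cnj y"
    using conj_quotient[OF xy(1)] conj_quotient[OF xy(2)] xy
    unfolding A_def B_def x_def[symmetric] y_def[symmetric] by (simp add: field_simps)
  finally show "wedge w\<^sub>2 w\<^sub>1 * wedge w\<^sub>3 w\<^sub>4 / (wedge w\<^sub>2 w\<^sub>4 * wedge w\<^sub>3 w\<^sub>1) =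
      cnj (wedge v\<^sub>2 v\<^sub>1 * wedge v\<^sub>3 v\<^sub>4 / (wedge v\<^sub>2 v\<^sub>4 * wedge v\<^sub>3 v\<^sub>1))"
    by (simp add: x_def y_def)
qed

section \<open>Stereographic projection\<close>

lemma norm_orthonormal_combination:
  fixes e\<^sub>1 e\<^sub>2 :: "'a::real_inner"
  assumes "norm e\<^sub>1 = 1" "norm e\<^sub>2 = 1" "e\<^sub>1 \<bullet> e\<^sub>2 = 0"
  shows "norm (Re z *\<^sub>R e\<^sub>1 + Im z *\<^sub>R e\<^sub>2) = cmod z"
proof -
  have "(norm (Re z *\<^sub>R e\<^sub>1 + Im z *\<^sub>R e\<^sub>2))\<^sup>2 = (cmod z)\<^sup>2"
    using assms unfolding power2_norm_eq_inner[of "_ + _"] cmod_power2 norm_eq_1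
    by (simp add: inner_add_left inner_add_right inner_commute power2_eq_square)
  then show ?thesis by simp
qed

text \<open>Stereographic projection from \<open>N\<close> is inversion at \<open>N\<close> followed by a similarity onto the image
  plane. So it changes the distance of \<open>x\<close> and \<open>y\<close> by a factor that is a product of
  a function of \<open>x\<close> and a function of \<open>y\<close>, and in homogeneous coordinates this includes the pole.\<close>

lemma stereographic_chordal_metric:
  assumes "stereographic_projection \<Sigma> p"
  obtains \<mu> :: "real ^ 4 \<Rightarrow> real" where "\<And>x. x \<in> \<Sigma> \<Longrightarrow> \<mu> x > 0"
    "\<And>x y. x \<in> \<Sigma> \<Longrightarrow> y \<in> \<Sigma> \<Longrightarrow> cmod (wedge (homog (p x)) (homog (p y))) = \<mu> x * \<mu> y * norm (x - y)"
proof -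
  obtain c r n N a e\<^sub>1 e\<^sub>2 where r: "r > 0" and \<Sigma>: "\<Sigma> = round_2sphere c r n" and N: "N \<in> \<Sigma>"
    and e: "norm e\<^sub>1 = 1" "norm e\<^sub>2 = 1" "e\<^sub>1 \<bullet> e\<^sub>2 = 0"
    and par: "e\<^sub>1 \<bullet> (N - c) = 0" "e\<^sub>2 \<bullet> (N - c) = 0"
    and off: "\<And>s t. N \<noteq> a + s *\<^sub>R e\<^sub>1 + t *\<^sub>R e\<^sub>2"
    and pN: "p N = Infty"
    and p: "\<And>x. x \<in> \<Sigma> - {N} \<Longrightarrow> \<exists>z. p x = Fin z \<and> a + Re z *\<^sub>R e\<^sub>1 + Im z *\<^sub>R e\<^sub>2 \<in> affine hull {N, x}"
    using assms unfolding stereographic_projection_def by blast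
  have Nc: "norm (N - c) = r" using N by (simp add: \<Sigma> round_2sphere_def dist_norm norm_minus_commute)
  define k where "k = 2 * ((N - a) \<bullet> (N - c))"
  have proj: "\<exists>z. p x = Fin z \<and> a + Re z *\<^sub>R e\<^sub>1 + Im z *\<^sub>R e\<^sub>2 = N + k *\<^sub>R flip N x"
    if x: "x \<in> \<Sigma>" "x \<noteq> N" for x
  proof -
    obtain z where z: "p x = Fin z" "a + Re z *\<^sub>R e\<^sub>1 + Im z *\<^sub>R e\<^sub>2 \<in> affine hull {N, x}"
      using p x by blast
    then obtain u v where uv: "u + v = 1" "a + Re z *\<^sub>R e\<^sub>1 + Im z *\<^sub>R e\<^sub>2 = u *\<^sub>R N + v *\<^sub>R x"
      unfolding affine_hull_2 by auto
    have "u *\<^sub>R N + v *\<^sub>R x = N + v *\<^sub>R (x - N)"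
      using uv(1) by (simp add: algebra_simps flip: scaleR_add_left)
    also have "x - N = (norm (x - N))\<^sup>2 *\<^sub>R flip N x" using x by (simp add: flip_def)
    finally have eq: "a + Re z *\<^sub>R e\<^sub>1 + Im z *\<^sub>R e\<^sub>2 = N + (v * (norm (x - N))\<^sup>2) *\<^sub>R flip N x"
      using uv(2) by simp
    have "norm (x - c) = r" using x by (simp add: \<Sigma> round_2sphere_def dist_norm norm_minus_commute)
    then have fl: "flip N x \<bullet> (N - c) = - 1 / 2" using flip_inner_sphere[OF Nc x(2)] by simp
    have "(a + Re z *\<^sub>R e\<^sub>1 + Im z *\<^sub>R e\<^sub>2) \<bullet> (N - c) = a \<bullet> (N - c)"
      by (simp add: inner_add_left par)
    then have "v * (norm (x - N))\<^sup>2 = k"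
      unfolding eq k_def by (simp add: inner_add_left inner_diff_left fl)
    with z eq show ?thesis by auto
  qed
  have nz: "k \<noteq> 0"
  proof
    assume "k = 0"
    \<comment> \<open>The antipode of the pole is a point of the 2-sphere other than the pole; its projection would be the pole itself.\<close>
    have "2 *\<^sub>R c - N \<in> \<Sigma>"
    proof -
      have eq: "2 *\<^sub>R c - N - c = - (N - c)" "c - (2 *\<^sub>R c - N) = N - c"
        by (simp_all add: scaleR_2)
      have "n \<bullet> (N - c) = 0" using N by (simp add: \<Sigma> round_2sphere_def)
      then show ?thesis using Nc
        unfolding \<Sigma> round_2sphere_def mem_Collect_eq mem_sphere dist_norm eq by (simp add: inner_diff_right)
    qed
    moreover have "2 *\<^sub>R c - N \<noteq> N"
    proof
      assume "2 *\<^sub>R c - N = N"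
      then have "2 *\<^sub>R (N - c) = 0" by (simp add: scaleR_2 algebra_simps)
      then show False using r Nc by simp
    qed
    ultimately obtain z where "a + Re z *\<^sub>R e\<^sub>1 + Im z *\<^sub>R e\<^sub>2 = N + k *\<^sub>R flip N (2 *\<^sub>R c - N)"
      using proj by blast
    with off[of "Re z" "Im z"] \<open>k = 0\<close> show False by simp
  qed
  define \<mu> where "\<mu> = (\<lambda>x. if x = N then 1 / sqrt \<bar>k\<bar> else sqrt \<bar>k\<bar> / norm (x - N))"
  have pos: "\<mu> x > 0" for x using nz by (simp add: \<mu>_def)
  have "cmod (wedge (homog (p x)) (homog (p y))) = \<mu> x * \<mu> y * norm (x - y)"
    if x: "x \<in> \<Sigma>" and y: "y \<in> \<Sigma>" for x y
  proof (cases "x = N")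
    case True
    show ?thesis
    proof (cases "y = N")
      case False
      then show ?thesis using proj[OF y False] True pN nz
        by (auto simp: wedge_def \<mu>_def norm_minus_commute)
    qed (simp add: True wedge_def)
  next
    case xN: False
    obtain z where z: "p x = Fin z" "a + Re z *\<^sub>R e\<^sub>1 + Im z *\<^sub>R e\<^sub>2 = N + k *\<^sub>R flip N x"
      using proj[OF x xN] by blast
    show ?thesis
    proof (cases "y = N")
      case True
      then show ?thesis using z pN nz xN by (simp add: wedge_def \<mu>_def)
    next
      case yN: False
      obtain w where w: "p y = Fin w" "a + Re w *\<^sub>R e\<^sub>1 + Im w *\<^sub>R e\<^sub>2 = N + k *\<^sub>R flip N y"
        using proj[OF y yN] by blast
      have "Re (z - w) *\<^sub>R e\<^sub>1 + Im (z - w) *\<^sub>R e\<^sub>2 =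
          (a + Re z *\<^sub>R e\<^sub>1 + Im z *\<^sub>R e\<^sub>2) - (a + Re w *\<^sub>R e\<^sub>1 + Im w *\<^sub>R e\<^sub>2)"
        by (simp add: algebra_simps)
      also have "\<dots> = k *\<^sub>R (flip N x - flip N y)" unfolding z w by (simp add: algebra_simps)
      finally have "cmod (z - w) = norm (k *\<^sub>R (flip N x - flip N y))"
        using norm_orthonormal_combination[OF e, of "z - w"] by simp
      also have "\<dots> = \<bar>k\<bar> * (norm (x - y) / (norm (x - N) * norm (y - N)))"
        using norm_flip_diff[OF xN yN] by simp
      also have "\<dots> = \<mu> x * \<mu> y * norm (x - y)"
        using xN yN by (simp add: \<mu>_def)
      finally show ?thesis using z w by (simp add: wedge_def)
    qed
  qed
  with pos show ?thesis using that by blast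
qed

lemma inner_incenter:
  assumes "w \<bullet> q = b" "w \<bullet> r = b" "w \<bullet> t = b" "q \<noteq> r"
  shows "w \<bullet> incenter q r t = b"
proof -
  have "norm (r - t) + norm (q - t) + norm (q - r) > 0"
    using assms(4) by (simp add: add_nonneg_pos)
  then show ?thesis
    using assms by (simp add: incenter_def inner_add_right flip: distrib_right)
qed

text \<open>Inversion at \<open>P\<close> maps the 2-sphere into an affine plane, which contains the incenter along with
  the vertices of the triangle.\<close>

lemma dual_point_on_sphere:
  assumes S: "P \<in> S3" "Q \<in> S3" "R \<in> S3" "T \<in> S3" and nc: "\<not> cocircular {P, Q, R, T}"
    and \<Sigma>: "{P, Q, R, T} \<subseteq> round_2sphere c r n"
  shows "dual_point P Q R T \<in> round_2sphere c r n" "dual_point P Q R T \<noteq> P"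
proof -
  define X where "X = dual_point P Q R T"
  have d: "distinct [P, Q, R, T]" by (rule not_cocircular_distinct[OF S nc])
  have fX: "flip P X = incenter (flip P Q) (flip P R) (flip P T)"
    unfolding X_def by (rule flip_dual_point[OF S nc])
  have ne: "flip P Q \<noteq> flip P R" using d by (metis distinct_length_2_or_more unflip_flip)
  have Pc: "norm (P - c) = r" "n \<bullet> (P - c) = 0"
    using \<Sigma> by (auto simp: round_2sphere_def dist_norm norm_minus_commute)
  have onS: "(P - c) \<bullet> flip P x = - 1 / 2" "n \<bullet> flip P x = 0" if "x \<in> {Q, R, T}" for x
  proof -
    have x: "x \<noteq> P" "norm (x - c) = r" "n \<bullet> (x - c) = 0"
      using that d \<Sigma> by (auto simp: round_2sphere_def dist_norm norm_minus_commute)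
    then show "(P - c) \<bullet> flip P x = - 1 / 2"
      using flip_inner_sphere[OF Pc(1)] by (simp add: inner_commute)
    have "n \<bullet> (x - P) = 0" using x(3) Pc(2) by (simp add: inner_diff_right)
    then show "n \<bullet> flip P x = 0" by (simp add: flip_def)
  qed
  have X: "(P - c) \<bullet> flip P X = - 1 / 2" "n \<bullet> flip P X = 0"
    unfolding fX using onS ne by (intro inner_incenter; simp)+
  then show XP: "dual_point P Q R T \<noteq> P" by (auto simp: X_def[symmetric] flip_def)
  then have nXP: "norm (X - P) \<noteq> 0" by (simp add: X_def)
  have "norm (X - c) = r"
    using flip_inner_sphere[OF Pc(1), of X] XP X(1) by (simp add: X_def[symmetric] inner_commute)
  moreover have "n \<bullet> (X - P) = 0" using X(2) nXP by (simp add: flip_def)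
  then have "n \<bullet> (X - c) = 0" using Pc(2) by (simp add: inner_diff_right)
  ultimately show "dual_point P Q R T \<in> round_2sphere c r n"
    by (simp add: X_def round_2sphere_def dist_norm norm_minus_commute)
qed

section \<open>The dual quadruplet in homogeneous coordinates\<close>

lemma incenter_proportional_weights:
  assumes "norm (r - t) = m * a" "norm (q - t) = m * b" "norm (q - r) = m * g" "m \<noteq> 0"
  shows "incenter q r t = (a / (a + b + g)) *\<^sub>R q + (b / (a + b + g)) *\<^sub>R r + (g / (a + b + g)) *\<^sub>R t"
proof -
  have "inverse (m * a + m * b + m * g) * (m * x) = x / (a + b + g)" for x
  proof -
    have "m * a + m * b + m * g = m * (a + b + g)" by (simp add: distrib_left)
    then show ?thesis using assms(4) by (simp add: divide_inverse)
  qed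
  then show ?thesis
    by (simp add: incenter_def assms scaleR_add_right)
qed

text \<open>The map \<open>g x = h x / wedge (h x) (h P)\<close> and inversion at \<open>P\<close> differ by a similarity: in both, the
  distance of the images of \<open>x\<close> and \<open>y\<close> is a constant times \<open>|x - y| / (|x - P| |y - P|)\<close>. So \<open>g\<close> also
  maps the dual point to the incenter, and the side lengths can be computed from wedges.\<close>

lemma homog_dual_point:
  assumes S: "P \<in> S3" "Q \<in> S3" "R \<in> S3" "T \<in> S3" and nc: "\<not> cocircular {P, Q, R, T}"
    and \<Sigma>: "{P, Q, R, T} \<subseteq> \<Sigma>" "dual_point P Q R T \<in> \<Sigma>" "dual_point P Q R T \<noteq> P"
    and pos: "\<And>x. x \<in> \<Sigma> \<Longrightarrow> \<mu> x > 0"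
    and chord: "\<And>x y. x \<in> \<Sigma> \<Longrightarrow> y \<in> \<Sigma> \<Longrightarrow> cmod (wedge (h x) (h y)) = \<mu> x * \<mu> y * norm (x - y)"
  obtains \<kappa> where "\<kappa> \<noteq> 0" "h (dual_point P Q R T) = cscale \<kappa> (dual_vector (h P) (h Q) (h R) (h T))"
proof -
  define X where "X = dual_point P Q R T"
  have d: "distinct [P, Q, R, T]" by (rule not_cocircular_distinct[OF S nc])
  have in\<Sigma>: "P \<in> \<Sigma>" "Q \<in> \<Sigma>" "R \<in> \<Sigma>" "T \<in> \<Sigma>" "X \<in> \<Sigma>" and XP: "X \<noteq> P"
    using \<Sigma> by (auto simp: X_def)
  have wnz: "wedge (h x) (h P) \<noteq> 0" if "x \<in> \<Sigma>" "x \<noteq> P" for x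
    using chord[OF that(1) in\<Sigma>(1)] pos[OF that(1)] pos[OF in\<Sigma>(1)] that(2)
    by (metis mult_eq_0_iff norm_eq_zero order_less_irrefl right_minus_eq)
  define g where "g = (\<lambda>x. cscale (1 / wedge (h x) (h P)) (h x))"
  define K where "K = norm (h P) / (\<mu> P)\<^sup>2"
  have sim: "norm (g x - g y) = K * norm (flip P x - flip P y)"
    if x: "x \<in> \<Sigma>" "x \<noteq> P" and y: "y \<in> \<Sigma>" "y \<noteq> P" for x y
  proof -
    have "norm (g x - g y) = cmod (wedge (h x) (h y)) / (cmod (wedge (h x) (h P)) * cmod (wedge (h y) (h P))) * norm (h P)"
      unfolding g_def wedge_quotient_diff[OF wnz[OF x] wnz[OF y]] norm_cscale
      by (simp add: norm_divide norm_mult)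
    also have "\<dots> = K * norm (flip P x - flip P y)"
      using pos[OF x(1)] pos[OF y(1)] pos[OF in\<Sigma>(1)] x y
      by (simp add: chord in\<Sigma> norm_flip_diff K_def power2_eq_square mult_ac)
    finally show ?thesis .
  qed
  define a b c s where "a = cmod (wedge (h Q) (h P) * wedge (h R) (h T))"
    and "b = cmod (wedge (h R) (h P) * wedge (h Q) (h T))"
    and "c = cmod (wedge (h T) (h P) * wedge (h Q) (h R))" and "s = a + b + c"
  define m where "m = 1 / (\<mu> P * \<mu> Q * \<mu> R * \<mu> T * norm (Q - P) * norm (R - P) * norm (T - P))"
  have \<mu>: "\<mu> P > 0" "\<mu> Q > 0" "\<mu> R > 0" "\<mu> T > 0" using pos in\<Sigma> by auto
  have nn: "norm (Q - P) > 0" "norm (R - P) > 0" "norm (T - P) > 0" "norm (R - T) > 0"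
    using d by auto
  have ne: "Q \<noteq> P" "R \<noteq> P" "T \<noteq> P" using d by auto
  have "m \<noteq> 0" using \<mu> nn by (simp add: m_def)
  have "norm (flip P R - flip P T) = m * a" "norm (flip P Q - flip P T) = m * b"
    "norm (flip P Q - flip P R) = m * c"
    using \<mu> nn ne unfolding a_def b_def c_def norm_mult
    by (simp_all add: norm_flip_diff m_def chord in\<Sigma>)
  from incenter_proportional_weights[OF this \<open>m \<noteq> 0\<close>]
  have fX: "flip P X = (a / s) *\<^sub>R flip P Q + (b / s) *\<^sub>R flip P R + (c / s) *\<^sub>R flip P T"
    using flip_dual_point[OF S nc] by (simp add: X_def s_def)
  have a: "a > 0" using \<mu> nn unfolding a_def norm_mult by (simp add: chord in\<Sigma>)
  have s: "s > 0" using a by (simp add: s_def b_def c_def add_pos_nonneg)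
  \<comment> \<open>The weights as a function of the vertex.\<close>
  define l where "l = (\<lambda>x. if x = Q then a / s else if x = R then b / s else c / s)"
  have sum3: "(\<Sum>x\<in>{Q, R, T}. l x *\<^sub>R f x) = (a / s) *\<^sub>R f Q + (b / s) *\<^sub>R f R + (c / s) *\<^sub>R f T"
    for f :: "real ^ 4 \<Rightarrow> 'z::real_vector"
    using d by (auto simp: l_def)
  have "g X = (\<Sum>x\<in>{Q, R, T}. l x *\<^sub>R g x)"
  proof (rule affine_combination_similarity)
    show "(\<Sum>x\<in>{Q, R, T}. l x) = 1"
      using sum3[of "\<lambda>_. 1::real"] s by (simp add: s_def flip: add_divide_distrib)
    show "flip P X = (\<Sum>x\<in>{Q, R, T}. l x *\<^sub>R flip P x)" unfolding sum3 fX ..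
    show "norm (g x - g y) = K * norm (flip P x - flip P y)"
      if "x \<in> insert X {Q, R, T}" "y \<in> insert X {Q, R, T}" for x y
      by (rule sim) (use that in\<Sigma> ne XP in auto)
  qed
  then have "g X = (a / s) *\<^sub>R g Q + (b / s) *\<^sub>R g R + (c / s) *\<^sub>R g T" unfolding sum3 .
  also have "\<dots> = cscale (1 / s) (dual_vector (h P) (h Q) (h R) (h T))"
    unfolding dual_vector_def a_def[symmetric] b_def[symmetric] c_def[symmetric] g_def
    by (simp add: cscale_def scaleR_conv_of_real algebra_simps)
  finally have gX: "g X = cscale (1 / s) (dual_vector (h P) (h Q) (h R) (h T))" .
  define w where "w = wedge (h X) (h P)"
  have w: "w \<noteq> 0" using wnz in\<Sigma> XP by (simp add: w_def)
  have "h X = cscale w (g X)" using w by (simp add: g_def w_def[symmetric] cscale_def)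
  also have "\<dots> = cscale (w / s) (dual_vector (h P) (h Q) (h R) (h T))"
    unfolding gX by (simp add: cscale_def)
  finally show ?thesis using that[of "w / s"] w s by (simp add: X_def)
qed

theorem theorem1p8:
  fixes P1 P2 P3 P4 P1' P2' P3' P4' c n :: "real ^ 4"
    and r :: real
    and \<Sigma> :: "(real ^ 4) set"
    and p :: "real ^ 4 \<Rightarrow> ecomplex"
  assumes "{P1, P2, P3, P4} \<subseteq> S3"
    and "\<not> cocircular {P1, P2, P3, P4}"
    and "P1' = dual_point P1 P2 P3 P4"
    and "P2' = dual_point P2 P1 P3 P4"
    and "P3' = dual_point P3 P1 P2 P4"
    and "P4' = dual_point P4 P1 P2 P3"
    and "r > 0" and "n \<noteq> 0" and "\<Sigma> = round_2sphere c r n" and "\<Sigma> \<subseteq> S3"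
    and "{P1, P2, P3, P4} \<subseteq> \<Sigma>"
    and "stereographic_projection \<Sigma> p"
  shows "cross_ratio (p P1') (p P2') (p P3') (p P4') =
         cnj (cross_ratio (p P1) (p P2) (p P3) (p P4))"
proof -
  obtain \<mu> where pos: "\<And>x. x \<in> \<Sigma> \<Longrightarrow> \<mu> x > 0"
    and chord: "\<And>x y. x \<in> \<Sigma> \<Longrightarrow> y \<in> \<Sigma> \<Longrightarrow>
      cmod (wedge (homog (p x)) (homog (p y))) = \<mu> x * \<mu> y * norm (x - y)"
    using stereographic_chordal_metric[OF assms(12)] by blast
  have S: "P1 \<in> S3" "P2 \<in> S3" "P3 \<in> S3" "P4 \<in> S3" using assms(1) by auto
  have in\<Sigma>: "P1 \<in> \<Sigma>" "P2 \<in> \<Sigma>" "P3 \<in> \<Sigma>" "P4 \<in> \<Sigma>" using assms(11) by auto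
  have nc: "\<not> cocircular {P1, P2, P3, P4}" "\<not> cocircular {P2, P1, P3, P4}"
    "\<not> cocircular {P3, P1, P2, P4}" "\<not> cocircular {P4, P1, P2, P3}"
    using assms(2) by (simp_all add: insert_commute)
  have dual: "\<exists>\<kappa>. \<kappa> \<noteq> 0 \<and> homog (p (dual_point P Q R T)) =
      cscale \<kappa> (dual_vector (homog (p P)) (homog (p Q)) (homog (p R)) (homog (p T)))"
    if "P \<in> S3 \<inter> \<Sigma>" "Q \<in> S3 \<inter> \<Sigma>" "R \<in> S3 \<inter> \<Sigma>" "T \<in> S3 \<inter> \<Sigma>" "\<not> cocircular {P, Q, R, T}" for P Q R T
  proof -
    have s: "P \<in> S3" "Q \<in> S3" "R \<in> S3" "T \<in> S3" and sub: "{P, Q, R, T} \<subseteq> \<Sigma>" using that by auto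
    note X = dual_point_on_sphere[OF s that(5) sub[unfolded assms(9)], folded assms(9)]
    show ?thesis
      using homog_dual_point[where h = "\<lambda>x. homog (p x)" and \<mu> = \<mu>, OF s that(5) sub X pos chord]
      by blast
  qed
  define v\<^sub>1 v\<^sub>2 v\<^sub>3 v\<^sub>4 where "v\<^sub>1 = homog (p P1)" and "v\<^sub>2 = homog (p P2)"
    and "v\<^sub>3 = homog (p P3)" and "v\<^sub>4 = homog (p P4)"
  define w\<^sub>1 w\<^sub>2 w\<^sub>3 w\<^sub>4 where "w\<^sub>1 = dual_vector v\<^sub>1 v\<^sub>2 v\<^sub>3 v\<^sub>4" and "w\<^sub>2 = dual_vector v\<^sub>2 v\<^sub>1 v\<^sub>3 v\<^sub>4"
    and "w\<^sub>3 = dual_vector v\<^sub>3 v\<^sub>1 v\<^sub>2 v\<^sub>4" and "w\<^sub>4 = dual_vector v\<^sub>4 v\<^sub>1 v\<^sub>2 v\<^sub>3"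
  obtain \<kappa>\<^sub>1 \<kappa>\<^sub>2 \<kappa>\<^sub>3 \<kappa>\<^sub>4 where \<kappa>: "\<kappa>\<^sub>1 \<noteq> 0" "\<kappa>\<^sub>2 \<noteq> 0" "\<kappa>\<^sub>3 \<noteq> 0" "\<kappa>\<^sub>4 \<noteq> 0"
    and h': "homog (p P1') = cscale \<kappa>\<^sub>1 w\<^sub>1" "homog (p P2') = cscale \<kappa>\<^sub>2 w\<^sub>2"
      "homog (p P3') = cscale \<kappa>\<^sub>3 w\<^sub>3" "homog (p P4') = cscale \<kappa>\<^sub>4 w\<^sub>4"
    using dual[OF _ _ _ _ nc(1)] dual[OF _ _ _ _ nc(2)] dual[OF _ _ _ _ nc(3)]
      dual[OF _ _ _ _ nc(4)] S in\<Sigma>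
    unfolding assms(3-6) v\<^sub>1_def v\<^sub>2_def v\<^sub>3_def v\<^sub>4_def w\<^sub>1_def w\<^sub>2_def w\<^sub>3_def w\<^sub>4_def by auto
  have wnz: "wedge (homog (p x)) (homog (p y)) \<noteq> 0" if "x \<in> \<Sigma>" "y \<in> \<Sigma>" "x \<noteq> y" for x y
    using chord[OF that(1,2)] pos[OF that(1)] pos[OF that(2)] that(3)
    by (metis mult_eq_0_iff norm_eq_zero order_less_irrefl right_minus_eq)
  have nz: "wedge v\<^sub>1 v\<^sub>2 \<noteq> 0" "wedge v\<^sub>1 v\<^sub>3 \<noteq> 0" "wedge v\<^sub>1 v\<^sub>4 \<noteq> 0"
    "wedge v\<^sub>2 v\<^sub>3 \<noteq> 0" "wedge v\<^sub>2 v\<^sub>4 \<noteq> 0" "wedge v\<^sub>3 v\<^sub>4 \<noteq> 0"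
    using not_cocircular_distinct[OF S nc(1)] in\<Sigma>
    by (simp_all add: v\<^sub>1_def v\<^sub>2_def v\<^sub>3_def v\<^sub>4_def wnz)
  note dv = cross_ratio_dual_vectors[OF nz, folded w\<^sub>1_def w\<^sub>2_def w\<^sub>3_def w\<^sub>4_def]
  have "cross_ratio (p P1') (p P2') (p P3') (p P4') =
      wedge w\<^sub>2 w\<^sub>1 * wedge w\<^sub>3 w\<^sub>4 / (wedge w\<^sub>2 w\<^sub>4 * wedge w\<^sub>3 w\<^sub>1)"
    using \<kappa> dv(1,2) by (subst cross_ratio_homog) (simp_all add: h' wedge_cscale)
  also have "\<dots> = cnj (cross_ratio (p P1) (p P2) (p P3) (p P4))"
    unfolding dv(3) using nz by (subst cross_ratio_homog) (simp_all add: v\<^sub>1_def v\<^sub>2_def v\<^sub>3_def v\<^sub>4_def)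
  finally show ?thesis .
qed

end
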